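(* Let $q$ be a prime power and $\mathbb{F}_q$ the field with $q$ elements. Let $\lambda \in \mathrm{CRS}_{\mathbb{F}_q}^e((\mathbb{F}_q)^{\mathbb{N}})$ with $\lambda\neq \delta_{(\mathbb{F}_q)^{\mathbb{N}}}$. Then there is a unique integer $\kappa\ge 0$ such that the random subgroup $h(\mathbb{F}_q^\kappa)$ has law $\lambda$, where $h\in\mathrm{Hom}_{\mathbb{F}_q}(\mathbb{F}_q^\kappa,(\mathbb{F}_q)^{\mathbb{N}})$ is a random homomorphism with law equal to the (normalized) Haar measure on the compact group $\mathrm{Hom}_{\mathbb{F}_q}(\mathbb{F}_q^\kappa,(\mathbb{F}_q)^{\mathbb{N}})$.
   Context: $(\mathbb{F}_q)^{\mathbb{N}}$ carries the (compact) product topology. For a locally compact (second countable) vector space $V$ over $\mathbb{F}_q$, $\mathrm{Sub}_{\mathbb{F}_q}(V)$ is the space of closed linear subspaces of $V$ with the topology induced from the Chabauty topology on closed subgroups ($H_i\to H$ iff limits of convergent sequences $g_j\in H_{i_j}$ along subsequences lie in $H$, and every $g\in H$ is a limit of some $g_i\in H_i$). $\mathrm{Aut}_{\mathbb{F}_q}(V)$ is the group of all linear homeomorphisms $V\to V$, acting on $\mathrm{Sub}_{\mathbb{F}_q}(V)$. $\mathrm{CRS}_{\mathbb{F}_q}(V)$ is the convex set of $\mathrm{Aut}_{\mathbb{F}_q}(V)$-invariant Borel probability measures on $\mathrm{Sub}_{\mathbb{F}_q}(V)$, and $\mathrm{CRS}^e_{\mathbb{F}_q}(V)$ is its set of extreme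 points. $\delta_W$ is the Dirac measure at the subspace $W$. $\mathrm{Hom}_{\mathbb{F}_q}$ denotes continuous linear maps, with the compact-open topology. *)

theory Defs
  imports "HOL-Probability.Probability" "HOL-Library.Function_Algebras"
begin

text \<open>
  A topological vector space \<open>V\<close> over a field is given by a scalar multiplication
  \<open>s :: 'a \<Rightarrow> 'v \<Rightarrow> 'v\<close> on an abelian group type and a topology \<open>T\<close> whose \<open>topspace\<close> is the
  underlying set of \<open>V\<close>; it may be a proper linear subspace of the type \<open>'v\<close>.
\<close>

section \<open>Borel sigma-algebra of an abstract topology\<close>

definition borel_of :: "'b topology \<Rightarrow> 'b measure" where
  "borel_of T = sigma (topspace T) {U. openin T U}"

section \<open>The Chabauty topology\<close>

definition closed_subgroups :: "'v::ab_group_add topology \<Rightarrow> 'v set set" where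
  "closed_subgroups T = {H. closedin T H \<and> 0 \<in> H \<and> (\<forall>x\<in>H. \<forall>y\<in>H. x - y \<in> H)}"

definition chabauty :: "'v::ab_group_add topology \<Rightarrow> 'v set topology" where
  "chabauty T = topology_generated_by
     ({{H \<in> closed_subgroups T. H \<inter> K = {}} | K. compactin T K} \<union>
      {{H \<in> closed_subgroups T. H \<inter> U \<noteq> {}} | U. openin T U})"

definition Sub :: "('a::field \<Rightarrow> 'v::ab_group_add \<Rightarrow> 'v) \<Rightarrow> 'v topology \<Rightarrow> 'v set set" where
  "Sub s T = {W. closedin T W \<and> module.subspace s W}"

definition Sub_topology ::
    "('a::field \<Rightarrow> 'v::ab_group_add \<Rightarrow> 'v) \<Rightarrow> 'v topology \<Rightarrow> 'v set topology" where
  "Sub_topology s T = subtopology (chabauty T) (Sub s T)"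

lemma topspace_chabauty [simp]: "topspace (chabauty T) = closed_subgroups T"
proof -
  have "closed_subgroups T = {H \<in> closed_subgroups T. H \<inter> {} = {}}" by simp
  moreover have "compactin T {}" by simp
  ultimately have "closed_subgroups T \<in> {{H \<in> closed_subgroups T. H \<inter> K = {}} | K. compactin T K}"
    by blast
  then show ?thesis
    unfolding chabauty_def topology_generated_by_topspace by auto
qed

text \<open>
  Over a locally compact metrizable group the topology above is the one whose convergent
  sequences are described by limits of subsequences and by approximation of points of the limit.
\<close>

lemma limitin_chabauty_iff:
  fixes T :: "'v::ab_group_add topology"
  assumes T: "metrizable_space T" "locally_compact_space T"
    and Hs: "\<And>i. Hs i \<in> closed_subgroups T" and H: "H \<in> closed_subgroups T"
  shows "limitin (chabauty T) Hs H sequentially \<longleftrightarrow>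
    (\<forall>r g x. strict_mono r \<and> (\<forall>j. g j \<in> Hs (r j)) \<and> limitin T g x sequentially \<longrightarrow> x \<in> H) \<and>
    (\<forall>x\<in>H. \<exists>g. (\<forall>i. g i \<in> Hs i) \<and> limitin T g x sequentially)"
    (is "?lim \<longleftrightarrow> ?A \<and> ?B")
proof -
  obtain M d where "Metric_space M d" and Teq: "T = Metric_space.mtopology M d"
    using T(1) unfolding metrizable_space_def by blast
  then interpret Metric_space M d by simp
  have topT: "topspace T = M" by (simp add: Teq)
  have HsM: "Hs i \<subseteq> M" for i
    using Hs[of i] closedin_subset topT by (auto simp: closed_subgroups_def)
  have clH: "closedin T H" and HM: "H \<subseteq> M"
    using H closedin_subset topT by (auto simp: closed_subgroups_def)
  have miss: "openin (chabauty T) {H \<in> closed_subgroups T. H \<inter> K = {}}" if "compactin T K" for K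
    unfolding chabauty_def by (rule topology_generated_by_Basis) (use that in blast)
  have hit: "openin (chabauty T) {H \<in> closed_subgroups T. H \<inter> U \<noteq> {}}" if "openin T U" for U
    unfolding chabauty_def by (rule topology_generated_by_Basis) (use that in blast)
  show ?thesis
  proof
    assume L: ?lim
    have ?A
    proof (intro allI impI, elim conjE, rule ccontr)
      fix r :: "nat \<Rightarrow> nat" and g x
      assume r: "strict_mono r" and g: "\<forall>j. g j \<in> Hs (r j)" and gx: "limitin T g x sequentially"
        and x: "x \<notin> H"
      have xM: "x \<in> M" using gx topT by (simp add: limitin_def)
      have "openin T (topspace T - H)" using clH by blast
      moreover have "x \<in> topspace T - H" using x xM topT by simp
      moreover have "neighbourhood_base_of (compactin T) T"
        using T metrizable_imp_Hausdorff_space locally_compact_space_neighbourhood_base by blast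
      ultimately obtain U K where UK: "openin T U" "compactin T K" "x \<in> U" "U \<subseteq> K"
          "K \<subseteq> topspace T - H"
        unfolding neighbourhood_base_of by meson
      have "\<forall>\<^sub>F i in sequentially. Hs i \<in> {H \<in> closed_subgroups T. H \<inter> K = {}}"
        using L miss[OF UK(2)] H UK(5) unfolding limitin_def by blast
      then have "\<forall>\<^sub>F i in sequentially. Hs i \<inter> K = {}"
        by (rule eventually_mono) simp
      then have "\<forall>\<^sub>F j in sequentially. Hs (r j) \<inter> K = {}"
        by (rule eventually_subseq[OF r])
      moreover have "\<forall>\<^sub>F j in sequentially. g j \<in> U"
        using gx UK by (simp add: limitin_def)
      ultimately have "\<forall>\<^sub>F j in sequentially. False"
      proof eventually_elim
        case (elim j)
        then show False using g[rule_format, of j] UK(4) by blast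
      qed
      then show False by simp
    qed
    moreover have ?B
    proof
      fix x assume x: "x \<in> H"
      define g where "g i = (SOME y. y \<in> Hs i \<and> (\<forall>z\<in>Hs i. d y x < d z x + 1 / Suc i))" for i
      have ex: "\<exists>y. y \<in> Hs i \<and> (\<forall>z\<in>Hs i. d y x < d z x + 1 / Suc i)" for i
      proof -
        let ?S = "(\<lambda>z. d z x) ` Hs i"
        have ne: "?S \<noteq> {}" using Hs[of i] by (auto simp: closed_subgroups_def)
        have bdd: "bdd_below ?S" by (rule bdd_belowI[of _ 0]) auto
        have "Inf ?S < Inf ?S + 1 / Suc i" by simp
        then obtain t where "t \<in> ?S" "t < Inf ?S + 1 / Suc i"
          using cInf_less_iff[OF ne bdd] by blast
        then obtain y where y: "y \<in> Hs i" "d y x < Inf ?S + 1 / Suc i" by auto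
        have "d y x < d z x + 1 / Suc i" if "z \<in> Hs i" for z
          using y(2) cInf_lower[OF _ bdd, of "d z x"] that by fastforce
        with y(1) show ?thesis by blast
      qed
      have g: "g i \<in> Hs i" "\<And>z. z \<in> Hs i \<Longrightarrow> d (g i) x < d z x + 1 / Suc i" for i
        using someI_ex[OF ex[of i]] unfolding g_def by auto
      have "limitin T g x sequentially"
        unfolding Teq limitin_metric
      proof (intro conjI allI impI)
        show "x \<in> M" using x HM by blast
        fix e :: real assume e: "e > 0"
        have "openin T (mball x (e/2))" by (simp add: Teq)
        moreover have "H \<inter> mball x (e/2) \<noteq> {}" using x HM e by force
        ultimately have "\<forall>\<^sub>F i in sequentially. Hs i \<in> {H \<in> closed_subgroups T. H \<inter> mball x (e/2) \<noteq> {}}"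
          using L hit H unfolding limitin_def by blast
        moreover have "\<forall>\<^sub>F i in sequentially. 1 / Suc i < e/2"
          using e order_tendstoD(2)[OF LIMSEQ_inverse_real_of_nat, of "e/2"]
          by (simp add: inverse_eq_divide)
        ultimately show "\<forall>\<^sub>F i in sequentially. g i \<in> M \<and> d (g i) x < e"
        proof eventually_elim
          case (elim i)
          then obtain z where "z \<in> Hs i" "d x z < e/2" by auto
          with g(2)[of z i] elim(2) have "d (g i) x < e" using commute[of x z] by linarith
          then show ?case using g(1)[of i] HsM by blast
        qed
      qed
      with g(1) show "\<exists>g. (\<forall>i. g i \<in> Hs i) \<and> limitin T g x sequentially" by blast
    qed
    ultimately show "?A \<and> ?B" ..
  next
    assume AB: "?A \<and> ?B"
    have ev: "H \<in> W \<Longrightarrow> \<forall>\<^sub>F i in sequentially. Hs i \<in> W"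
      if "generate_topology_on ({{H \<in> closed_subgroups T. H \<inter> K = {}} | K. compactin T K} \<union>
        {{H \<in> closed_subgroups T. H \<inter> U \<noteq> {}} | U. openin T U}) W" for W
      using that
    proof (induction rule: generate_topology_on.induct)
      case Empty
      then show ?case by simp
    next
      case (Int a b)
      then show ?case by (auto intro: eventually_conj)
    next
      case (UN \<K>)
      then obtain k where k: "k \<in> \<K>" "H \<in> k" by blast
      with UN.IH have "\<forall>\<^sub>F i in sequentially. Hs i \<in> k" by blast
      then show ?case by (rule eventually_mono) (use k in blast)
    next
      case (Basis W)
      then consider K where "compactin T K" "W = {H \<in> closed_subgroups T. H \<inter> K = {}}"
        | U where "openin T U" "W = {H \<in> closed_subgroups T. H \<inter> U \<noteq> {}}" by blast
      then show ?case
      proof cases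
        case (1 K)
        have "\<forall>\<^sub>F i in sequentially. Hs i \<inter> K = {}"
        proof (rule ccontr)
          assume "\<not> ?thesis"
          then have inf: "infinite {i. Hs i \<inter> K \<noteq> {}}"
            unfolding cofinite_eq_sequentially[symmetric] eventually_cofinite by simp
          obtain r :: "nat \<Rightarrow> nat" where r: "strict_mono r" "\<And>n. r n \<in> {i. Hs i \<inter> K \<noteq> {}}"
            using infinite_enumerate[OF inf] by auto
          define g where "g n = (SOME x. x \<in> Hs (r n) \<inter> K)" for n
          have g: "g n \<in> Hs (r n) \<inter> K" for n
            using r(2)[of n] some_in_eq[of "Hs (r n) \<inter> K"] by (simp add: g_def)
          then have "range g \<subseteq> K" by auto
          with 1(1) obtain l t where l: "l \<in> K" "strict_mono t" "limitin mtopology (g \<circ> t) l sequentially"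
            unfolding Teq compactin_sequentially by blast
          have "strict_mono (r \<circ> t)" using r(1) l(2) by (simp add: strict_mono_o)
          moreover have "\<forall>j. (g \<circ> t) j \<in> Hs ((r \<circ> t) j)" using g by auto
          ultimately have "l \<in> H" using AB l(3) unfolding Teq by blast
          with l(1) Basis.prems 1(2) show False by auto
        qed
        then show ?thesis using 1(2) Hs by simp
      next
        case (2 U)
        then obtain x where x: "x \<in> H" "x \<in> U" using Basis.prems by auto
        with AB obtain g where g: "\<forall>i. g i \<in> Hs i" "limitin T g x sequentially" by blast
        then have "\<forall>\<^sub>F i in sequentially. g i \<in> U" using 2(1) x by (simp add: limitin_def)
        then show ?thesis by (rule eventually_mono) (use g(1) 2(2) Hs in auto)
      qed
    qed
    show ?lim
      unfolding limitin_def topspace_chabauty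
    proof (intro conjI allI impI)
      show "H \<in> closed_subgroups T" by (rule H)
      fix W assume W: "openin (chabauty T) W \<and> H \<in> W"
      then have "openin (chabauty T) W" by blast
      from openin_topology_generated_by[OF this[unfolded chabauty_def]] W
      show "\<forall>\<^sub>F i in sequentially. Hs i \<in> W" using ev by blast
    qed
  qed
qed

section \<open>Characteristic random subspaces\<close>

definition linear_on ::
    "('a::field \<Rightarrow> 'v::ab_group_add \<Rightarrow> 'v) \<Rightarrow> ('a \<Rightarrow> 'w::ab_group_add \<Rightarrow> 'w) \<Rightarrow> 'v set \<Rightarrow> ('v \<Rightarrow> 'w) \<Rightarrow> bool"
  where
  "linear_on s1 s2 S f \<longleftrightarrow>
     (\<forall>x\<in>S. \<forall>y\<in>S. f (x + y) = f x + f y) \<and> (\<forall>c. \<forall>x\<in>S. f (s1 c x) = s2 c (f x))"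

definition Aut :: "('a::field \<Rightarrow> 'v::ab_group_add \<Rightarrow> 'v) \<Rightarrow> 'v topology \<Rightarrow> ('v \<Rightarrow> 'v) set" where
  "Aut s T = {\<phi>. homeomorphic_map T T \<phi> \<and> linear_on s s (topspace T) \<phi>}"

definition CRS :: "('a::field \<Rightarrow> 'v::ab_group_add \<Rightarrow> 'v) \<Rightarrow> 'v topology \<Rightarrow> 'v set measure set" where
  "CRS s T = {\<mu>. prob_space \<mu> \<and> sets \<mu> = sets (borel_of (Sub_topology s T)) \<and>
     (\<forall>\<phi>\<in>Aut s T. distr \<mu> (borel_of (Sub_topology s T)) (\<lambda>W. \<phi> ` W) = \<mu>)}"

text \<open>
  Measures do not form a \<open>real_vector\<close> type, so \<open>extreme_point_of\<close> does not apply and is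
  restated with setwise convex combinations.
\<close>

definition extreme_measures :: "'b measure set \<Rightarrow> 'b measure set" where
  "extreme_measures C = {\<mu> \<in> C. \<forall>\<nu>1\<in>C. \<forall>\<nu>2\<in>C. \<forall>t::real. 0 < t \<and> t < 1 \<and>
     (\<forall>A\<in>sets \<mu>. measure \<mu> A = (1 - t) * measure \<nu>1 A + t * measure \<nu>2 A) \<longrightarrow> \<nu>1 = \<nu>2}"

definition CRSe :: "('a::field \<Rightarrow> 'v::ab_group_add \<Rightarrow> 'v) \<Rightarrow> 'v topology \<Rightarrow> 'v set measure set" where
  "CRSe s T = extreme_measures (CRS s T)"

section \<open>Continuous homomorphisms and Haar measure\<close>

text \<open>
  Homomorphisms are \<open>extensional\<close> on the underlying set of the domain, so that they are
  determined by their values there.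
\<close>

definition Hom :: "('a::field \<Rightarrow> 'v::ab_group_add \<Rightarrow> 'v) \<Rightarrow> 'v topology \<Rightarrow>
    ('a \<Rightarrow> 'w::ab_group_add \<Rightarrow> 'w) \<Rightarrow> 'w topology \<Rightarrow> ('v \<Rightarrow> 'w) set" where
  "Hom s1 T1 s2 T2 = {h \<in> extensional (topspace T1).
     continuous_map T1 T2 h \<and> linear_on s1 s2 (topspace T1) h}"

definition Hom_topology :: "('a::field \<Rightarrow> 'v::ab_group_add \<Rightarrow> 'v) \<Rightarrow> 'v topology \<Rightarrow>
    ('a \<Rightarrow> 'w::ab_group_add \<Rightarrow> 'w) \<Rightarrow> 'w topology \<Rightarrow> ('v \<Rightarrow> 'w) topology" where
  "Hom_topology s1 T1 s2 T2 = topology_generated_by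
     {{h \<in> Hom s1 T1 s2 T2. h ` K \<subseteq> U} | K U. compactin T1 K \<and> openin T2 U}"

definition Hom_add :: "'v topology \<Rightarrow> ('v \<Rightarrow> 'w::ab_group_add) \<Rightarrow> ('v \<Rightarrow> 'w) \<Rightarrow> ('v \<Rightarrow> 'w)" where
  "Hom_add T1 g h = (\<lambda>x\<in>topspace T1. g x + h x)"

text \<open>
  Normalized Haar measure of a compact second countable group with underlying space \<open>T\<close> and
  group operation \<open>m\<close>; every Borel probability measure on such a space is regular, so regularity
  is not required explicitly.
\<close>

definition is_normalized_haar :: "'g topology \<Rightarrow> ('g \<Rightarrow> 'g \<Rightarrow> 'g) \<Rightarrow> 'g measure \<Rightarrow> bool" where
  "is_normalized_haar T m \<mu> \<longleftrightarrow> prob_space \<mu> \<and> sets \<mu> = sets (borel_of T) \<and>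
     (\<forall>g\<in>topspace T. distr \<mu> (borel_of T) (m g) = \<mu>)"

definition normalized_haar :: "'g topology \<Rightarrow> ('g \<Rightarrow> 'g \<Rightarrow> 'g) \<Rightarrow> 'g measure" where
  "normalized_haar T m = (THE \<mu>. is_normalized_haar T m \<mu>)"

definition Hom_haar :: "('a::field \<Rightarrow> 'v::ab_group_add \<Rightarrow> 'v) \<Rightarrow> 'v topology \<Rightarrow>
    ('a \<Rightarrow> 'w::ab_group_add \<Rightarrow> 'w) \<Rightarrow> 'w topology \<Rightarrow> ('v \<Rightarrow> 'w) measure" where
  "Hom_haar s1 T1 s2 T2 = normalized_haar (Hom_topology s1 T1 s2 T2) (Hom_add T1)"

section \<open>The spaces \<open>F\<^sup>I\<close>\<close>

text \<open>
  For a set \<open>I\<close> of indices, \<open>F\<^sup>I\<close> is realized as the sequences supported in \<open>I\<close>, with the product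
  of the discrete topologies. Thus \<open>I = UNIV\<close> gives all sequences and \<open>I = {..<k}\<close> gives \<open>F\<^sup>k\<close>.
\<close>

definition fscale :: "'a::field \<Rightarrow> (nat \<Rightarrow> 'a) \<Rightarrow> (nat \<Rightarrow> 'a)" where
  "fscale c x = (\<lambda>i. c * x i)"

definition seq_space :: "nat set \<Rightarrow> (nat \<Rightarrow> 'a::field) topology" where
  "seq_space I = subtopology (product_topology (\<lambda>_. discrete_topology UNIV) UNIV)
     {x. \<forall>i. i \<notin> I \<longrightarrow> x i = 0}"

lemma vector_space_fscale: "vector_space (fscale :: 'a::field \<Rightarrow> _)"
  by unfold_locales (auto simp: fscale_def algebra_simps)

lemma topspace_seq_space: "topspace (seq_space I) = {x. \<forall>i. i \<notin> I \<longrightarrow> x i = 0}"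
  by (simp add: seq_space_def)

end

theory Submission
  imports Defs
begin

text \<open>
  Let \<open>W\<close> have law \<open>\<lambda>\<close>. The cardinality of \<open>W\<close> is invariant under automorphisms, so extremality makes
  it almost surely constant. The law of \<open>W\<close> is determined by the laws of its projections to \<open>F\<^sup>n\<close>. By
  invariance, the law of the projection does not change if a uniformly random linear function of the
  coordinates \<open>n, \<dots>, m - 1\<close> is added to the first \<open>n\<close> coordinates. If \<open>W\<close> has \<open>q\<^sup>k\<close> elements, then
  almost surely it meets \<open>F\<^sup>n\<close> trivially, hence embeds into the coordinates \<open>n, \<dots>, m - 1\<close> for large
  \<open>m\<close>, and the sheared projection is exactly the image of a uniformly random map \<open>F\<^sup>k \<rightarrow> F\<^sup>n\<close>. If \<open>W\<close> is
  infinite, the same argument applied to subspaces of \<open>W\<close> of growing dimension shows that each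
  projection is onto, so that \<open>W\<close> is the whole space.
\<close>

section \<open>Truncations and finite families of linear maps\<close>

text \<open>A shear that reads the coordinates from \<open>n\<close> on and writes into the first
  \<open>n\<close> fixes F^n pointwise, so vectors of W inside F^n cannot be randomized. This is why
  the finite case has to exclude them beforehand and the infinite case works modulo F^n. The shears
  reading only coordinates below m form a finite group, so averages are finite counts; no single m
  serves every W, whence the limit in m and dominated convergence. In the infinite case a uniformly
  random linear map from F^k to F^n misses a given vector with probability at most (1 - q^(-n))^k,
  which vanishes as k grows. The two laws in the theorem are compared numerically: on either side,
  the probability that the projection to F^n equals E is the proportion of linear maps from F^k to
  F^n with range E. Haar measure is a definite description; it becomes computable because invariance
  amounts to giving every linear map from F^k to F^n the same probability, and independent uniform
  matrix entries realize it. The exponent k is recovered from the probability q^(-k) that the first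
  coordinate vanishes on the random subspace.\<close>

definition trunc :: "nat \<Rightarrow> (nat \<Rightarrow> 'a::zero) \<Rightarrow> (nat \<Rightarrow> 'a)" where
  "trunc n x = (\<lambda>i. if i < n then x i else 0)"

definition window :: "nat \<Rightarrow> nat \<Rightarrow> (nat \<Rightarrow> 'a::zero) \<Rightarrow> (nat \<Rightarrow> 'a)" where
  "window m n x = (\<lambda>i. if m \<le> i \<and> i < n then x i else 0)"

abbreviation lin :: "((nat \<Rightarrow> 'a::field) \<Rightarrow> (nat \<Rightarrow> 'a)) \<Rightarrow> bool" where
  "lin \<equiv> Vector_Spaces.linear fscale fscale"

text \<open>
  Linear maps on \<open>F\<^sup>k\<close> are represented by the linear maps \<open>g\<close> on all sequences with
  \<open>g \<circ> trunc k = g\<close>; similarly \<open>Q\<close> is a projection onto the codomain.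
\<close>

definition Lin :: "((nat \<Rightarrow> 'a) \<Rightarrow> (nat \<Rightarrow> 'a)) \<Rightarrow> ((nat \<Rightarrow> 'a) \<Rightarrow> (nat \<Rightarrow> 'a)) \<Rightarrow>
    ((nat \<Rightarrow> 'a::field) \<Rightarrow> (nat \<Rightarrow> 'a)) set" where
  "Lin P Q = {g. lin g \<and> g \<circ> P = g \<and> Q \<circ> g = g}"

interpretation fs: vector_space "fscale :: 'a::field \<Rightarrow> _"
  by (rule vector_space_fscale)

interpretation fsp: vector_space_pair "fscale :: 'a::field \<Rightarrow> _" "fscale :: 'a::field \<Rightarrow> _"
  by unfold_locales

lemma trunc_trunc: "trunc m (trunc n x) = trunc (min m n) x"
  by (auto simp: trunc_def)

lemma trunc_eq_iff: "trunc n x = trunc n y \<longleftrightarrow> (\<forall>i<n. x i = y i)"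
  by (auto simp: trunc_def fun_eq_iff)

lemma trunc_eq_mono: "trunc n x = trunc n y \<Longrightarrow> m \<le> n \<Longrightarrow> trunc m x = trunc m y"
  by (auto simp: trunc_eq_iff)

lemma trunc_0 [simp]: "trunc 0 x = (0 :: nat \<Rightarrow> 'a::zero)"
  by (simp add: trunc_def fun_eq_iff)

lemma trunc_add: "trunc n (x + y) = trunc n x + trunc n (y :: nat \<Rightarrow> 'a::field)"
  by (auto simp: trunc_def fun_eq_iff)

lemma trunc_diff: "trunc n (x - y) = trunc n x - trunc n (y :: nat \<Rightarrow> 'a::field)"
  by (auto simp: trunc_def fun_eq_iff)

lemma lin_iff: "lin f \<longleftrightarrow> (\<forall>x y. f (x + y) = f x + f y) \<and> (\<forall>c x. f (fscale c x) = fscale c (f x))"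
  using Vector_Spaces.linear_iff[of fscale fscale f] by (simp add: vector_space_fscale)

lemma lin_0: "lin f \<Longrightarrow> f 0 = 0"
  by (metis lin_iff add_cancel_left_left)

lemma lin_diff: "lin f \<Longrightarrow> f (x - y) = f x - f y"
  by (metis lin_iff diff_add_cancel eq_diff_eq)

lemma lin_trunc: "lin (trunc n)"
  by (auto simp: lin_iff trunc_def fscale_def fun_eq_iff)

lemma lin_window: "lin (window m n)"
  by (auto simp: lin_iff window_def fscale_def fun_eq_iff)

lemma lin_add: "lin f \<Longrightarrow> lin g \<Longrightarrow> lin (\<lambda>x. f x + g x)"
  by (auto simp: lin_iff fs.scale_right_distrib algebra_simps)

lemma lin_sub: "lin f \<Longrightarrow> lin g \<Longrightarrow> lin (\<lambda>x. f x - g x)"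
  by (auto simp: lin_iff fs.scale_right_diff_distrib algebra_simps)

lemma lin_comp: "lin f \<Longrightarrow> lin g \<Longrightarrow> lin (\<lambda>x. f (g x))"
  by (auto simp: lin_iff)

lemma lin_id: "lin (\<lambda>x. x)"
  by (auto simp: lin_iff)

lemma lin_zero: "lin (\<lambda>x. 0)"
  by (auto simp: lin_iff)

lemma lin_imp_linear_on: "lin f \<Longrightarrow> linear_on fscale fscale S f"
  by (auto simp: lin_iff linear_on_def)

lemma subspace_range_lin: "lin f \<Longrightarrow> fs.subspace (range f)"
  unfolding fs.subspace_def
  by (metis (no_types, lifting) lin_0 lin_iff rangeE rangeI)

lemma subspace_image_trunc: "fs.subspace (range (trunc n))"
  by (rule subspace_range_lin[OF lin_trunc])

lemma mem_range_trunc: "x \<in> range (trunc n) \<longleftrightarrow> (\<forall>i\<ge>n. x i = 0)"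
proof
  assume "\<forall>i\<ge>n. x i = 0"
  then have "x = trunc n x" by (auto simp: trunc_def fun_eq_iff)
  then show "x \<in> range (trunc n)" by blast
qed (auto simp: trunc_def)

lemma topspace_seq_space_lessThan: "topspace (seq_space {..<k}) = range (trunc k)"
  unfolding topspace_seq_space set_eq_iff mem_range_trunc by auto

lemma range_trunc_fixed: "x \<in> range (trunc n) \<Longrightarrow> trunc n x = x"
  by (auto simp: trunc_trunc)

lemma CARD_field_gt_1: "CARD('a::{field,finite}) > 1"
  using card_mono[of UNIV "{0, 1 :: 'a}"] by simp

lemma card_range_trunc:
  "card (range (trunc k :: _ \<Rightarrow> nat \<Rightarrow> 'a::{field,finite})) = CARD('a) ^ k"
  and finite_range_trunc: "finite (range (trunc k :: _ \<Rightarrow> nat \<Rightarrow> 'a::{field,finite}))"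
proof -
  have "bij_betw (\<lambda>x. restrict x {..<k}) (range (trunc k :: _ \<Rightarrow> nat \<Rightarrow> 'a)) ({..<k} \<rightarrow>\<^sub>E UNIV)"
  proof (rule bij_betw_byWitness[where f' = "trunc k"])
    show "trunc k ` ({..<k} \<rightarrow>\<^sub>E UNIV) \<subseteq> range (trunc k :: _ \<Rightarrow> nat \<Rightarrow> 'a)" by blast
  qed (auto simp: trunc_def fun_eq_iff PiE_def extensional_def)
  then show "card (range (trunc k :: _ \<Rightarrow> nat \<Rightarrow> 'a)) = CARD('a) ^ k"
    "finite (range (trunc k :: _ \<Rightarrow> nat \<Rightarrow> 'a))"
    by (auto simp: bij_betw_same_card card_funcsetE bij_betw_finite finite_PiE card_PiE)
qed

lemma window_window: "window m n (window m n x) = window m n x"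
  by (auto simp: window_def)

lemma finite_range_window: "finite (range (window m n :: _ \<Rightarrow> nat \<Rightarrow> 'a::{field,finite}))"
proof (rule finite_subset[OF _ finite_range_trunc[of n]])
  show "range (window m n :: _ \<Rightarrow> nat \<Rightarrow> 'a) \<subseteq> range (trunc n)"
    by (auto simp: mem_range_trunc window_def)
qed

lemma LinD:
  assumes "g \<in> Lin P Q"
  shows "lin g" "g (P x) = g x" "Q (g x) = g x"
  using assms by (auto simp: Lin_def fun_eq_iff)

lemma LinI: "lin g \<Longrightarrow> (\<And>x. g (P x) = g x) \<Longrightarrow> (\<And>x. Q (g x) = g x) \<Longrightarrow> g \<in> Lin P Q"
  by (auto simp: Lin_def fun_eq_iff)

lemma Lin_zero: "lin Q \<Longrightarrow> (\<lambda>_. 0) \<in> Lin P Q"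
proof (rule LinI)
  show "lin (\<lambda>_. 0)" by (rule lin_zero)
qed (simp_all only: lin_0)

lemma Lin_diff: "g \<in> Lin P Q \<Longrightarrow> h \<in> Lin P Q \<Longrightarrow> lin Q \<Longrightarrow> (\<lambda>x. g x - h x) \<in> Lin P Q"
  by (intro LinI lin_sub) (auto simp: LinD lin_diff)

lemma Lin_add: "g \<in> Lin P Q \<Longrightarrow> h \<in> Lin P Q \<Longrightarrow> lin Q \<Longrightarrow> (\<lambda>x. g x + h x) \<in> Lin P Q"
  by (intro LinI lin_add) (auto simp: LinD lin_iff[of Q])

lemma finite_Lin:
  assumes "finite (range P)" "finite (range Q)"
  shows "finite (Lin P Q)"
proof (rule finite_subset)
  show "Lin P Q \<subseteq> (\<lambda>f x. f (P x)) ` (range P \<rightarrow>\<^sub>E range Q)"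
  proof
    fix g assume g: "g \<in> Lin P Q"
    have "restrict g (range P) \<in> range P \<rightarrow>\<^sub>E range Q"
      using LinD(3)[OF g] by (auto simp: PiE_def) (metis rangeI)
    moreover have "g = (\<lambda>x. restrict g (range P) (P x))"
      using LinD(2)[OF g] by (auto simp: fun_eq_iff)
    ultimately show "g \<in> (\<lambda>f x. f (P x)) ` (range P \<rightarrow>\<^sub>E range Q)" by blast
  qed
  show "finite ((\<lambda>f x. f (P x)) ` (range P \<rightarrow>\<^sub>E range Q))"
    by (rule finite_imageI[OF finite_PiE]) (use assms in auto)
qed

lemma lin_sum: "lin g \<Longrightarrow> g (\<Sum>i\<in>I. f i) = (\<Sum>i\<in>I. g (f i))"
  by (induction I rule: infinite_finite_induct) (auto simp: lin_0 lin_iff)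

section \<open>Counting linear maps by their columns\<close>

definition unit_seq :: "nat \<Rightarrow> nat \<Rightarrow> 'a::field" where
  "unit_seq i = (\<lambda>j. if j = i then 1 else 0)"

lemma trunc_eq_sum: "trunc k x = (\<Sum>i<k. fscale (x i) (unit_seq i))"
proof (induction k)
  case 0
  then show ?case by (simp add: zero_fun_def)
next
  case (Suc k)
  have "trunc (Suc k) x = trunc k x + fscale (x k) (unit_seq k)"
    by (auto simp: trunc_def fscale_def unit_seq_def fun_eq_iff less_Suc_eq)
  then show ?case by (simp add: Suc)
qed

lemma Lin_trunc_eq_sum:
  assumes g: "g \<in> Lin (trunc k) Q"
  shows "g x = (\<Sum>i<k. fscale (x i) (g (unit_seq i)))"
proof -
  have "g x = g (trunc k x)" using LinD(2)[OF g] by simp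
  also have "\<dots> = (\<Sum>i<k. g (fscale (x i) (unit_seq i)))"
    by (simp add: trunc_eq_sum lin_sum[OF LinD(1)[OF g]])
  also have "\<dots> = (\<Sum>i<k. fscale (x i) (g (unit_seq i)))"
    using LinD(1)[OF g] by (simp add: lin_iff)
  finally show ?thesis .
qed

text \<open>F^k is free on its standard basis, so the columns of a linear map can be chosen
  arbitrarily. Idempotence of \<open>Q\<close> turns "column in \<open>range Q\<close>" into "column
  fixed by \<open>Q\<close>".\<close>

lemma bij_betw_Lin_trunc:
  fixes Q :: "(nat \<Rightarrow> 'a::field) \<Rightarrow> nat \<Rightarrow> 'a"
  assumes Q: "lin Q" "\<And>x. Q (Q x) = Q x"
  shows "bij_betw (\<lambda>g. \<lambda>i\<in>{..<k}. g (unit_seq i)) (Lin (trunc k) Q) ({..<k} \<rightarrow>\<^sub>E range Q)"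
proof (rule bij_betw_byWitness[where f' = "\<lambda>u x. \<Sum>i<k. fscale (x i) (u i)"])
  show "\<forall>g\<in>Lin (trunc k) Q. (\<lambda>x. \<Sum>i<k. fscale (x i) ((\<lambda>i\<in>{..<k}. g (unit_seq i)) i)) = g"
  proof (intro ballI ext)
    fix g :: "(nat \<Rightarrow> 'a) \<Rightarrow> nat \<Rightarrow> 'a" and x :: "nat \<Rightarrow> 'a"
    assume "g \<in> Lin (trunc k) Q"
    from Lin_trunc_eq_sum[OF this, of x]
    show "(\<Sum>i<k. fscale (x i) ((\<lambda>i\<in>{..<k}. g (unit_seq i)) i)) j = g x j" for j by simp
  qed
  have unit: "(\<Sum>j<k. fscale (unit_seq i j) (u j)) = u i" if "i < k" for i and u :: "nat \<Rightarrow> nat \<Rightarrow> 'a"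
  proof -
    have "(\<Sum>j<k. fscale (unit_seq i j) (u j)) = (\<Sum>j<k. if j = i then u j else 0)"
      by (intro sum.cong) (auto simp: unit_seq_def fscale_def zero_fun_def)
    then show ?thesis using that by simp
  qed
  show "\<forall>u\<in>{..<k} \<rightarrow>\<^sub>E range Q. (\<lambda>i\<in>{..<k}. \<Sum>j<k. fscale (unit_seq i j) (u j)) = u"
    by (auto simp: unit PiE_def extensional_def intro!: ext)
  show "(\<lambda>g. \<lambda>i\<in>{..<k}. g (unit_seq i)) ` Lin (trunc k) Q \<subseteq> {..<k} \<rightarrow>\<^sub>E range Q"
    using LinD(3)[where P = "trunc k" and Q = Q] by (auto simp: PiE_def) (metis rangeI)
  show "(\<lambda>u x. \<Sum>i<k. fscale (x i) (u i)) ` ({..<k} \<rightarrow>\<^sub>E range Q) \<subseteq> Lin (trunc k) Q"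
  proof (intro image_subsetI LinI)
    fix u assume u: "u \<in> {..<k} \<rightarrow>\<^sub>E range Q"
    show "lin (\<lambda>x. \<Sum>i<k. fscale (x i) (u i))"
      unfolding lin_iff
    proof (intro conjI allI)
      fix c and x :: "nat \<Rightarrow> 'a"
      have "fscale (fscale c x i) (u i) = fscale c (fscale (x i) (u i))" for i
        by (simp add: fscale_def mult.assoc)
      then show "(\<Sum>i<k. fscale (fscale c x i) (u i)) = fscale c (\<Sum>i<k. fscale (x i) (u i))"
        by (simp only: fs.scale_sum_right)
    qed (simp add: fs.scale_left_distrib sum.distrib)
    show "(\<Sum>i<k. fscale (trunc k x i) (u i)) = (\<Sum>i<k. fscale (x i) (u i))" for x
      by (intro sum.cong) (auto simp: trunc_def)
    have "Q (u i) = u i" if "i < k" for i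
      using u that Q(2) by (auto simp: PiE_def Pi_def)
    then show "Q (\<Sum>i<k. fscale (x i) (u i)) = (\<Sum>i<k. fscale (x i) (u i))" for x
      using Q(1) by (simp add: lin_sum lin_iff)
  qed
qed

lemma card_Lin_trunc:
  "card (Lin (trunc k) (trunc n) :: ((nat \<Rightarrow> 'a::{field,finite}) \<Rightarrow> _) set) = (CARD('a) ^ n) ^ k"
  using bij_betw_same_card[OF bij_betw_Lin_trunc[of "trunc n :: (nat \<Rightarrow> 'a) \<Rightarrow> _" k]]
  by (simp add: lin_trunc trunc_trunc card_PiE card_range_trunc)

lemma finite_Lin_trunc: "finite (Lin (trunc k) (trunc n) :: ((nat \<Rightarrow> 'a::{field,finite}) \<Rightarrow> _) set)"
  by (intro finite_Lin finite_range_trunc)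

text \<open>A map that misses \<open>v\<close> has no column equal to \<open>v\<close>. This is only
  a necessary condition, hence the inequality; the crude bound is enough because, relative to all
  maps, it decays geometrically in \<open>k\<close> for fixed \<open>n\<close>.\<close>

lemma card_Lin_trunc_miss:
  fixes v :: "nat \<Rightarrow> 'a::{field,finite}"
  assumes v: "v \<in> range (trunc n)"
  shows "card {g \<in> Lin (trunc k) (trunc n). v \<notin> range g} \<le> (CARD('a) ^ n - 1) ^ k"
proof -
  let ?\<Phi> = "\<lambda>g :: (nat \<Rightarrow> 'a) \<Rightarrow> _. \<lambda>i\<in>{..<k}. g (unit_seq i)"
  have bij: "bij_betw ?\<Phi> (Lin (trunc k) (trunc n)) ({..<k} \<rightarrow>\<^sub>E range (trunc n))"
    by (rule bij_betw_Lin_trunc) (auto simp: lin_trunc trunc_trunc)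
  have "card {g \<in> Lin (trunc k) (trunc n). v \<notin> range g} \<le> card ({..<k} \<rightarrow>\<^sub>E (range (trunc n) - {v}))"
  proof (rule card_inj_on_le)
    show "inj_on ?\<Phi> {g \<in> Lin (trunc k) (trunc n). v \<notin> range g}"
      by (rule inj_on_subset[OF bij_betw_imp_inj_on[OF bij]]) auto
    show "?\<Phi> ` {g \<in> Lin (trunc k) (trunc n). v \<notin> range g} \<subseteq> {..<k} \<rightarrow>\<^sub>E (range (trunc n) - {v})"
    proof (intro image_subsetI PiE_I)
      fix g i assume g: "g \<in> {g \<in> Lin (trunc k) (trunc n). v \<notin> range g}" and i: "i \<in> {..<k}"
      have "trunc n (g (unit_seq i)) = g (unit_seq i)" using g LinD(3) by blast
      moreover have "g (unit_seq i) \<noteq> v" using g by blast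
      ultimately show "?\<Phi> g i \<in> range (trunc n) - {v}" using i by (simp add: mem_range_trunc) (metis mem_range_trunc rangeI)
    qed auto
    show "finite ({..<k} \<rightarrow>\<^sub>E (range (trunc n) - {v}))"
      by (intro finite_PiE finite_Diff finite_range_trunc) auto
  qed
  also have "\<dots> = (CARD('a) ^ n - 1) ^ k"
    using v by (simp add: card_PiE card_range_trunc finite_range_trunc card_Diff_singleton)
  finally show ?thesis .
qed

section \<open>Equidistribution under random shears\<close>

text \<open>A map with equal fibres pushes the uniform distribution on \<open>A\<close> to the
  uniform distribution on \<open>B\<close>. The cross-multiplied form keeps the count in the natural
  numbers and covers empty \<open>B\<close>.\<close>

lemma card_filter_equal_fibres:
  assumes "finite A" "finite B" "f \<in> A \<rightarrow> B"
    and fib: "\<And>y z. y \<in> B \<Longrightarrow> z \<in> B \<Longrightarrow> card {x \<in> A. f x = y} = card {x \<in> A. f x = z}"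
  shows "card {x \<in> A. P (f x)} * card B = card A * card {y \<in> B. P y}"
proof (cases "B = {}")
  case False
  then obtain y0 where y0: "y0 \<in> B" by blast
  define c where "c = card {x \<in> A. f x = y0}"
  have count: "card {x \<in> A. Q (f x)} = card {y \<in> B. Q y} * c" for Q
  proof -
    have "{x \<in> A. Q (f x)} = (\<Union>y\<in>{y \<in> B. Q y}. {x \<in> A. f x = y})"
      using assms(3) by auto
    also have "card \<dots> = (\<Sum>y\<in>{y \<in> B. Q y}. card {x \<in> A. f x = y})"
      using assms(1,2) by (intro card_UN_disjoint) auto
    also have "\<dots> = (\<Sum>y\<in>{y \<in> B. Q y}. c)"
      using fib[OF _ y0] by (intro sum.cong) (auto simp: c_def)
    finally show ?thesis by simp
  qed
  \<comment> \<open>The constantly true predicate computes \<open>card A\<close> as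
    \<open>card B * c\<close>.\<close>
  show ?thesis using count[of P] count[of "\<lambda>_. True"] by simp
qed (use assms in auto)

text \<open>
  If \<open>\<psi>\<close> embeds \<open>F\<^sup>k\<close> and its image stays embedded when only the coordinates in \<open>[n, m)\<close> are kept,
  then adding to the first \<open>n\<close> coordinates a uniformly random linear function of the coordinates in
  \<open>[n, m)\<close> turns the first \<open>n\<close> coordinates of \<open>\<psi>\<close> into a uniformly random linear map: every fibre of
  this affine map of finite groups is a translate of the same subgroup.
\<close>

lemma card_shear_fibres:
  fixes \<psi> :: "(nat \<Rightarrow> 'a::{field,finite}) \<Rightarrow> nat \<Rightarrow> 'a"
  assumes \<psi>: "lin \<psi>" "\<And>x. \<psi> (trunc k x) = \<psi> x"
    and inj: "\<And>x. window n m (\<psi> x) = 0 \<Longrightarrow> trunc k x = 0"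
  shows "card {b \<in> Lin (window n m) (trunc n). P (\<lambda>x. trunc n (\<psi> x + b (\<psi> x)))} *
      card (Lin (trunc k) (trunc n) :: ((nat \<Rightarrow> 'a) \<Rightarrow> _) set) =
    card (Lin (window n m) (trunc n) :: ((nat \<Rightarrow> 'a) \<Rightarrow> _) set) *
      card {g \<in> Lin (trunc k) (trunc n). P g}"
proof (rule card_filter_equal_fibres)
  let ?A = "Lin (window n m) (trunc n) :: ((nat \<Rightarrow> 'a) \<Rightarrow> _) set"
  let ?B = "Lin (trunc k) (trunc n) :: ((nat \<Rightarrow> 'a) \<Rightarrow> _) set"
  let ?\<Theta> = "\<lambda>b x. trunc n (\<psi> x + b (\<psi> x))"
  show "finite ?A" "finite ?B"
    by (intro finite_Lin finite_range_trunc finite_range_window)+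
  show "?\<Theta> \<in> ?A \<rightarrow> ?B"
  proof
    fix b assume "b \<in> ?A"
    then have b: "lin b" by (rule LinD)
    show "?\<Theta> b \<in> ?B"
      by (rule LinI) (auto simp: \<psi> trunc_trunc intro!: lin_comp[OF lin_trunc] lin_add lin_comp[OF b])
  qed
  have surj: "\<exists>b\<in>?A. ?\<Theta> b = g" if g: "g \<in> ?B" for g
  proof -
    \<comment> \<open>The correction that a shear has to add to the first \<open>n\<close>
      coordinates of \<open>\<psi> x\<close> in order to produce \<open>g x\<close>.\<close>
    define u where "u x = g x - trunc n (\<psi> x)" for x
    have u: "lin u" "\<And>x. u (trunc k x) = u x" "\<And>x. trunc n (u x) = u x"
      unfolding u_def using LinD[OF g] \<psi>
      by (auto intro!: lin_sub lin_comp[OF lin_trunc] simp: trunc_diff trunc_trunc)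
    define w where "w x = window n m (\<psi> x)" for x
    have w: "lin w" unfolding w_def by (rule lin_comp[OF lin_window \<psi>(1)])
    \<comment> \<open>The span is the subspace \<open>range (trunc k)\<close> itself; it is written
      as a span to match the theorem on linear left inverses.\<close>
    have "inj_on w (fs.span (range (trunc k)))"
    proof (rule inj_onI)
      fix x y assume xy: "x \<in> fs.span (range (trunc k))" "y \<in> fs.span (range (trunc k))" "w x = w y"
      then have "x \<in> range (trunc k)" "y \<in> range (trunc k)"
        unfolding fs.span_eq_iff[THEN iffD2, OF subspace_image_trunc[of k]] by simp_all
      then have "trunc k x = x" "trunc k y = y" by (blast intro: range_trunc_fixed)+
      moreover have "w (x - y) = 0" using xy lin_diff[OF w] by simp
      then have "trunc k (x - y) = 0" using inj by (simp add: w_def)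
      ultimately show "x = y" by (simp add: trunc_diff)
    qed
    from fsp.linear_inj_on_left_inverse[OF w this] obtain L
      where L: "lin L" "\<forall>x\<in>fs.span (range (trunc k)). L (w x) = x" by blast
    \<comment> \<open>The left inverse \<open>L\<close> recovers \<open>trunc k x\<close> from the
      window coordinates of \<open>\<psi> x\<close>, so the correction \<open>u\<close> can be
      expressed through these coordinates alone.\<close>
    define b where "b x = u (L (window n m x))" for x
    have "b \<in> ?A"
      unfolding b_def using u L(1)
      by (intro LinI lin_comp[OF u(1)] lin_comp[OF L(1)] lin_window) (auto simp: window_window)
    moreover have "b (\<psi> x) = u x" for x
    proof -
      have "trunc k x \<in> fs.span (range (trunc k))" by (rule fs.span_base) blast
      then have "L (w (trunc k x)) = trunc k x" using L(2) by blast
      then show ?thesis using u(2) \<psi>(2) by (simp add: b_def w_def)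
    qed
    then have "?\<Theta> b = g" by (auto simp: trunc_add u(3)) (simp add: u_def)
    ultimately show ?thesis by blast
  qed
  have le: "card {b \<in> ?A. ?\<Theta> b = g} \<le> card {b \<in> ?A. ?\<Theta> b = h}" if gh: "g \<in> ?B" "h \<in> ?B" for g h
  proof -
    obtain b0 b1 where b: "b0 \<in> ?A" "?\<Theta> b0 = g" "b1 \<in> ?A" "?\<Theta> b1 = h"
      using surj[OF gh(1)] surj[OF gh(2)] by blast
    let ?t = "\<lambda>b x. b x + (b1 x - b0 x)"
    show ?thesis
    proof (rule card_inj_on_le[where f = ?t])
      show "inj_on ?t {b \<in> ?A. ?\<Theta> b = g}" by (rule inj_onI) (auto simp: fun_eq_iff)
      show "?t ` {b \<in> ?A. ?\<Theta> b = g} \<subseteq> {b \<in> ?A. ?\<Theta> b = h}"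
      proof safe
        fix b assume "b \<in> ?A" and eq: "g = ?\<Theta> b"
        then show "?t b \<in> ?A" using b by (intro Lin_add Lin_diff lin_trunc)
        have "?\<Theta> (?t b) x = h x" for x
        proof -
          have "?\<Theta> (?t b) x = ?\<Theta> b x + (?\<Theta> b1 x - ?\<Theta> b0 x)" by (simp add: trunc_add trunc_diff)
          also have "\<dots> = g x + (h x - g x)" using b eq by (metis (no_types, lifting))
          finally show ?thesis by simp
        qed
        then show "?\<Theta> (?t b) = h" by blast
      qed
      show "finite {b \<in> ?A. ?\<Theta> b = h}"
        by (intro finite_subset[OF _ \<open>finite ?A\<close>]) auto
    qed
  qed
  show "card {b \<in> ?A. ?\<Theta> b = g} = card {b \<in> ?A. ?\<Theta> b = h}" if "g \<in> ?B" "h \<in> ?B" for g h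
    using le that by (intro antisym) auto
qed

section \<open>Parametrizing subspaces\<close>

text \<open>A copy of F^k inside \<open>W\<close> that stays injective modulo \<open>U\<close>. It
  is used with \<open>U = {0}\<close>, for plain injectivity, and with
  \<open>U = range (trunc n)\<close>, for injectivity after the first \<open>n\<close> coordinates
  are discarded.\<close>

definition embeds :: "nat \<Rightarrow> ((nat \<Rightarrow> 'a::field) \<Rightarrow> nat \<Rightarrow> 'a) \<Rightarrow> (nat \<Rightarrow> 'a) set \<Rightarrow> (nat \<Rightarrow> 'a) set \<Rightarrow> bool"
  where
  "embeds k \<psi> W U \<longleftrightarrow> lin \<psi> \<and> (\<forall>x. \<psi> (trunc k x) = \<psi> x) \<and> range \<psi> \<subseteq> W \<and> (\<forall>x. \<psi> x \<in> U \<longrightarrow> trunc k x = 0)"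

lemma embeds_0: "fs.subspace W \<Longrightarrow> embeds 0 (\<lambda>_. 0) W U"
  by (simp add: embeds_def lin_zero fs.subspace_0)

text \<open>A vector outside \<open>U + range \<psi>\<close> is independent of the image modulo
  \<open>U\<close> and can be the image of the next basis vector: a relation with nonzero
  coefficient \<open>x k\<close> could be divided by it and solved for \<open>w\<close>.\<close>

lemma embeds_Suc:
  fixes W U :: "(nat \<Rightarrow> 'a::field) set"
  assumes e: "embeds k \<psi> W U" and W: "fs.subspace W" and U: "fs.subspace U"
    and w: "w \<in> W" "\<And>u x. u \<in> U \<Longrightarrow> w \<noteq> u + \<psi> x"
  shows "embeds (Suc k) (\<lambda>x. \<psi> x + fscale (x k) w) W U"
  unfolding embeds_def
proof (intro conjI allI impI)
  have \<psi>: "lin \<psi>" "\<psi> (trunc k x) = \<psi> x" "range \<psi> \<subseteq> W" for x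
    using e by (auto simp: embeds_def)
  show "lin (\<lambda>x. \<psi> x + fscale (x k) w)"
    by (intro lin_add \<psi>) (auto simp: lin_iff fscale_def fun_eq_iff algebra_simps)
  show "\<psi> (trunc (Suc k) x) + fscale (trunc (Suc k) x k) w = \<psi> x + fscale (x k) w" for x
    using \<psi>(2)[of "trunc (Suc k) x"] \<psi>(2)[of x]
    by (simp add: trunc_trunc) (simp add: trunc_def)
  show "range (\<lambda>x. \<psi> x + fscale (x k) w) \<subseteq> W"
    using \<psi>(3) W w(1) by (auto intro!: fs.subspace_add fs.subspace_scale)
  fix x assume x: "\<psi> x + fscale (x k) w \<in> U"
  have "x k = 0"
  proof (rule ccontr)
    assume nz: "x k \<noteq> 0"
    have "fscale (inverse (x k)) (\<psi> x + fscale (x k) w) \<in> U"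
      using x U by (rule fs.subspace_scale[rotated])
    moreover have "w = fscale (inverse (x k)) (\<psi> x + fscale (x k) w) + \<psi> (fscale (- inverse (x k)) x)"
    proof -
      have "\<psi> (fscale (- inverse (x k)) x) = fscale (- inverse (x k)) (\<psi> x)"
        using \<psi>(1) unfolding lin_iff by blast
      then show ?thesis using nz by (auto simp: fscale_def fun_eq_iff algebra_simps)
    qed
    ultimately show False using w(2) by blast
  qed
  moreover from this x have "\<psi> x \<in> U" by simp
  then have "trunc k x = 0" using e by (simp add: embeds_def)
  ultimately show "trunc (Suc k) x = 0"
    by (auto simp: trunc_def fun_eq_iff less_Suc_eq) metis
qed

lemma embeds_range:
  assumes "embeds k \<psi> W U"
  shows "range \<psi> = \<psi> ` range (trunc k)"
proof -
  have "\<psi> = \<psi> \<circ> trunc k" using assms by (simp add: embeds_def fun_eq_iff)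
  then show ?thesis by (metis image_comp)
qed

text \<open>At every stage \<open>U + range \<psi>\<close> is finite, so an infinite
  \<open>W\<close> always offers a vector that extends the embedding.\<close>

lemma embeds_infinite:
  fixes W U :: "(nat \<Rightarrow> 'a::{field,finite}) set"
  assumes W: "fs.subspace W" "infinite W" and U: "fs.subspace U" "finite U"
  shows "\<exists>\<psi>. embeds k \<psi> W U"
proof (induction k)
  case 0
  then show ?case using embeds_0[OF W(1)] by blast
next
  case (Suc k)
  then obtain \<psi> where \<psi>: "embeds k \<psi> W U" by blast
  have "range \<psi> = \<psi> ` range (trunc k)" by (rule embeds_range[OF \<psi>])
  then have "finite (range \<psi>)" by (metis finite_imageI finite_range_trunc)
  then have "finite ((\<lambda>(u, y). u + y) ` (U \<times> range \<psi>))" using U(2) by blast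
  then obtain w where "w \<in> W" "w \<notin> (\<lambda>(u, y). u + y) ` (U \<times> range \<psi>)"
    using W(2) by (meson finite_subset subsetI)
  with embeds_Suc[OF \<psi> W(1) U(1), of w] show ?case by blast
qed

lemma embeds_card:
  fixes W U :: "(nat \<Rightarrow> 'a::{field,finite}) set"
  assumes "embeds k \<psi> W U" "0 \<in> U"
  shows "card (range \<psi>) = CARD('a) ^ k"
proof -
  have \<psi>: "lin \<psi>" "\<psi> (trunc k x) = \<psi> x" "\<psi> x = 0 \<Longrightarrow> trunc k x = 0" for x
    using assms by (auto simp: embeds_def)
  have "inj_on \<psi> (range (trunc k))"
  proof (rule inj_onI)
    fix x y assume xy: "x \<in> range (trunc k)" "y \<in> range (trunc k)" "\<psi> x = \<psi> y"
    then have "trunc k (x - y) = 0" using \<psi>(3)[of "x - y"] lin_diff[OF \<psi>(1)] by simp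
    then show "x = y"
      using range_trunc_fixed[OF xy(1)] range_trunc_fixed[OF xy(2)] by (simp add: trunc_diff)
  qed
  moreover have "range \<psi> = \<psi> ` range (trunc k)" by (rule embeds_range[OF assms(1)])
  ultimately show ?thesis by (simp add: card_image card_range_trunc)
qed

text \<open>An embedding of maximal dimension must exhaust \<open>W\<close>, since a vector outside
  its range would extend it. This provides a coordinate system on \<open>W\<close>.\<close>

lemma embeds_finite:
  fixes W :: "(nat \<Rightarrow> 'a::{field,finite}) set"
  assumes W: "fs.subspace W" "finite W"
  obtains k \<psi> where "embeds k \<psi> W {0}" "range \<psi> = W"
proof -
  \<comment> \<open>A crude bound on the dimension, whose only purpose is to make the greatest
    \<open>k\<close> exist.\<close>
  have le: "k \<le> card W" if "embeds k \<psi> W {0}" for k \<psi>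
  proof -
    have "k \<le> CARD('a) ^ k"
    proof -
      have "2 \<le> CARD('a)" using CARD_field_gt_1[where 'a = 'a] by simp
      then have "2 ^ k \<le> CARD('a) ^ k" by (rule power_mono) simp
      then show ?thesis using less_exp[of k] by linarith
    qed
    also have "\<dots> \<le> card W"
      using embeds_card[OF that] card_mono[OF W(2), of "range \<psi>"] that by (simp add: embeds_def)
    finally show ?thesis .
  qed
  define k where "k = (GREATEST k. \<exists>\<psi>. embeds k \<psi> W {0})"
  have "\<exists>\<psi>. embeds k \<psi> W {0}"
    unfolding k_def by (rule GreatestI_nat[where k = 0 and b = "card W"]) (use embeds_0[OF W(1)] le in blast)+
  then obtain \<psi> where \<psi>: "embeds k \<psi> W {0}" by blast
  have "range \<psi> = W"
  proof (rule ccontr)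
    assume "range \<psi> \<noteq> W"
    moreover have "range \<psi> \<subseteq> W" using \<psi> by (simp add: embeds_def)
    ultimately obtain w where "w \<in> W" "w \<notin> range \<psi>" by blast
    then have "embeds (Suc k) (\<lambda>x. \<psi> x + fscale (x k) w) W {0}"
      by (intro embeds_Suc[OF \<psi> W(1)]) (auto simp: fs.subspace_single_0)
    then have "Suc k \<le> k" unfolding k_def
      by (intro Greatest_le_nat[where b = "card W"]) (use le in blast)+
    then show False by simp
  qed
  with \<psi> that show ?thesis by blast
qed

text \<open>A vector outside F^n has a nonzero coordinate at some index at least \<open>n\<close>,
  which the window sees once \<open>m\<close> exceeds that index. The range of \<psi> is finite, so
  one threshold works for all its vectors.\<close>

lemma embeds_eventually_window:
  fixes \<psi> :: "(nat \<Rightarrow> 'a::{field,finite}) \<Rightarrow> nat \<Rightarrow> 'a"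
  assumes \<psi>: "embeds k \<psi> W (range (trunc n))"
  shows "\<forall>\<^sub>F m in sequentially. \<forall>x. window n m (\<psi> x) = 0 \<longrightarrow> trunc k x = 0"
proof -
  have "range \<psi> = \<psi> ` range (trunc k)" by (rule embeds_range[OF \<psi>])
  then have fin: "finite (range \<psi>)" by (metis finite_imageI finite_range_trunc)
  have "\<forall>\<^sub>F m in sequentially. \<forall>y\<in>range \<psi>. window n m y = 0 \<longrightarrow> y \<in> range (trunc n)"
  proof (intro eventually_ball_finite[OF fin] ballI)
    fix y :: "nat \<Rightarrow> 'a"
    show "\<forall>\<^sub>F m in sequentially. window n m y = 0 \<longrightarrow> y \<in> range (trunc n)"
    proof (cases "y \<in> range (trunc n)")
      case False
      then obtain i where i: "n \<le> i" "y i \<noteq> 0" by (auto simp: mem_range_trunc)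
      show ?thesis using eventually_gt_at_top[of i]
      proof eventually_elim
        case (elim m)
        then have "window n m y i \<noteq> 0" using i by (simp add: window_def)
        then show ?case by force
      qed
    qed simp
  qed
  then show ?thesis
    by (rule eventually_mono) (use \<psi> in \<open>auto simp: embeds_def\<close>)
qed

section \<open>The Borel structure on the space of closed subspaces\<close>

lemma space_borel_of: "space (borel_of T) = topspace T"
  unfolding borel_of_def by (rule space_measure_of) (auto dest: openin_subset)

lemma sets_borel_of: "sets (borel_of T) = sigma_sets (topspace T) {U. openin T U}"
  unfolding borel_of_def by (rule sets_measure_of) (auto dest: openin_subset)

text \<open>Every open set is a countable union of members of \<open>C\<close>. These are only asked
  to be Borel, which spares a separate proof that trace events are open.\<close>

lemma sets_borel_of_countable_base:
  assumes C: "countable C" "C \<subseteq> sets (borel_of T)"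
    and base: "\<And>U x. openin T U \<Longrightarrow> x \<in> U \<Longrightarrow> \<exists>A\<in>C. x \<in> A \<and> A \<subseteq> U"
  shows "sets (borel_of T) = sigma_sets (topspace T) C"
proof
  show "sigma_sets (topspace T) C \<subseteq> sets (borel_of T)"
    using sets.sigma_sets_subset[OF C(2)] by (simp add: space_borel_of)
  show "sets (borel_of T) \<subseteq> sigma_sets (topspace T) C"
    unfolding sets_borel_of
  proof (rule sigma_sets_mono, rule subsetI)
    fix U assume "U \<in> {U. openin T U}"
    then have "U = \<Union>{A \<in> C. A \<subseteq> U}" using base by blast
    moreover have "countable {A \<in> C. A \<subseteq> U}" using C(1) by (rule countable_subset[rotated]) auto
    then have "\<Union>{A \<in> C. A \<subseteq> U} \<in> sigma_sets (topspace T) C"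
      by (rule sigma_sets_UNION) (auto intro: sigma_sets.Basic)
    ultimately show "U \<in> sigma_sets (topspace T) C" by simp
  qed
qed

section \<open>The topology of sequence spaces\<close>

lemma openin_product_discrete:
  fixes U :: "(nat \<Rightarrow> 'a::zero) set"
  shows "openin (product_topology (\<lambda>_. discrete_topology UNIV) UNIV) U \<longleftrightarrow>
    (\<forall>x\<in>U. \<exists>n. \<forall>y. trunc n y = trunc n x \<longrightarrow> y \<in> U)"
  unfolding openin_product_topology_alt
proof (intro ball_cong refl iffI)
  fix x :: "nat \<Rightarrow> 'a"
  assume "\<exists>X. finite {i \<in> UNIV. X i \<noteq> topspace (discrete_topology UNIV)} \<and>
    (\<forall>i\<in>UNIV. openin (discrete_topology UNIV) (X i)) \<and> x \<in> Pi\<^sub>E UNIV X \<and> Pi\<^sub>E UNIV X \<subseteq> U"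
  then obtain X where X: "finite {i. X i \<noteq> UNIV}" "\<And>i. x i \<in> X i" "Pi\<^sub>E UNIV X \<subseteq> U"
    by (auto simp: PiE_UNIV_domain)
  obtain n where n: "\<forall>i\<in>{i. X i \<noteq> UNIV}. i < n"
    using X(1) finite_nat_set_iff_bounded by blast
  have "y \<in> U" if "trunc n y = trunc n x" for y
  proof -
    have "y i \<in> X i" for i
      using X(2)[of i] that n by (cases "X i = UNIV") (auto simp: trunc_eq_iff)
    then show ?thesis using X(3) by (auto simp: PiE_UNIV_domain)
  qed
  then show "\<exists>n. \<forall>y. trunc n y = trunc n x \<longrightarrow> y \<in> U" by blast
next
  fix x :: "nat \<Rightarrow> 'a"
  assume "\<exists>n. \<forall>y. trunc n y = trunc n x \<longrightarrow> y \<in> U"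
  then obtain n where n: "\<And>y. trunc n y = trunc n x \<Longrightarrow> y \<in> U" by blast
  have "finite {i. (if i < n then {x i} else UNIV) \<noteq> (UNIV :: 'a set)}"
    by (rule finite_subset[of _ "{..<n}"]) auto
  moreover have "Pi\<^sub>E UNIV (\<lambda>i. if i < n then {x i} else UNIV) \<subseteq> U"
  proof
    fix y assume y: "y \<in> Pi\<^sub>E UNIV (\<lambda>i. if i < n then {x i} else UNIV)"
    have "y i = x i" if "i < n" for i
      using PiE_mem[OF y, of i] that by simp
    then show "y \<in> U" by (intro n) (auto simp: trunc_eq_iff)
  qed
  ultimately show "\<exists>X. finite {i \<in> UNIV. X i \<noteq> topspace (discrete_topology UNIV)} \<and>
    (\<forall>i\<in>UNIV. openin (discrete_topology UNIV) (X i)) \<and> x \<in> Pi\<^sub>E UNIV X \<and> Pi\<^sub>E UNIV X \<subseteq> U"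
    by (intro exI[of _ "\<lambda>i. if i < n then {x i} else UNIV"]) (auto simp: PiE_UNIV_domain)
qed

lemma openin_seq_space:
  fixes U :: "(nat \<Rightarrow> 'a::field) set"
  shows "openin (seq_space I) U \<longleftrightarrow> U \<subseteq> topspace (seq_space I) \<and>
    (\<forall>x\<in>U. \<exists>n. \<forall>y\<in>topspace (seq_space I). trunc n y = trunc n x \<longrightarrow> y \<in> U)"
  (is "?L \<longleftrightarrow> ?R")
proof
  assume ?L
  then show ?R
    using openin_subset[of "seq_space I" U]
    unfolding topspace_seq_space
    by (fastforce simp: seq_space_def openin_subtopology openin_product_discrete)
next
  assume R: ?R
  then obtain n where n: "\<And>x y. x \<in> U \<Longrightarrow> y \<in> topspace (seq_space I) \<Longrightarrow>
      trunc (n x) y = trunc (n x) x \<Longrightarrow> y \<in> U" by metis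
  \<comment> \<open>The union of full cylinders around the points of \<open>U\<close>: open in the
    whole product, with trace \<open>U\<close> on the subspace.\<close>
  define T where "T = {y. \<exists>x\<in>U. trunc (n x) y = trunc (n x) x}"
  have "U = T \<inter> topspace (seq_space I)" using R n by (auto simp: T_def)
  moreover have "openin (product_topology (\<lambda>_. discrete_topology UNIV) UNIV) T"
    unfolding openin_product_discrete T_def by auto metis
  ultimately show ?L unfolding seq_space_def openin_subtopology
    by (auto simp: topspace_seq_space)
qed

lemma topspace_seq_space_UNIV [simp]: "topspace (seq_space UNIV) = UNIV"
  by (simp add: topspace_seq_space)

lemma openin_seq_space_UNIV:
  fixes U :: "(nat \<Rightarrow> 'a::field) set"
  shows "openin (seq_space UNIV) U \<longleftrightarrow> (\<forall>x\<in>U. \<exists>n. \<forall>y. trunc n y = trunc n x \<longrightarrow> y \<in> U)"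
  by (simp add: openin_seq_space)

lemma openin_cylinder: "openin (seq_space UNIV) {y :: nat \<Rightarrow> 'a::field. trunc n y = z}"
  unfolding openin_seq_space_UNIV by auto

lemma finite_imp_closedin_seq_space:
  fixes S :: "(nat \<Rightarrow> 'a::field) set"
  assumes "finite S"
  shows "closedin (seq_space UNIV) S"
  unfolding closedin_def openin_seq_space_UNIV
proof (intro conjI ballI)
  fix x assume "x \<in> topspace (seq_space UNIV) - S"
  then have "\<forall>s\<in>S. \<exists>i. s i \<noteq> x i" by (metis Diff_iff ext)
  then obtain i where i: "\<And>s. s \<in> S \<Longrightarrow> s (i s) \<noteq> x (i s)" by metis
  obtain n where "\<forall>j\<in>i ` S. j < n"
    using assms finite_nat_set_iff_bounded by blast
  then show "\<exists>n. \<forall>y. trunc n y = trunc n x \<longrightarrow> y \<in> topspace (seq_space UNIV) - S"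
    using i by (intro exI[of _ n]) (auto simp: trunc_eq_iff)
qed simp

section \<open>Hit and miss events in the Chabauty space\<close>

abbreviation SubV :: "(nat \<Rightarrow> 'a::field) set set" where
  "SubV \<equiv> Sub fscale (seq_space UNIV)"

abbreviation SubT :: "(nat \<Rightarrow> 'a::field) set topology" where
  "SubT \<equiv> Sub_topology fscale (seq_space UNIV)"

lemma SubV_iff: "W \<in> SubV \<longleftrightarrow> closedin (seq_space UNIV) W \<and> fs.subspace W"
  by (simp add: Sub_def)

lemma finite_subspace_SubV: "fs.subspace W \<Longrightarrow> finite W \<Longrightarrow> W \<in> SubV"
  by (simp add: SubV_iff finite_imp_closedin_seq_space)

lemma SubV_subset_closed_subgroups: "SubV \<subseteq> closed_subgroups (seq_space UNIV)"
  by (auto simp: SubV_iff closed_subgroups_def fs.subspace_0 fs.subspace_diff)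

lemma topspace_SubT: "topspace SubT = SubV"
  using SubV_subset_closed_subgroups by (auto simp: Sub_topology_def)

lemma space_borel_SubT: "space (borel_of SubT) = SubV"
  by (simp add: space_borel_of topspace_SubT)

lemma openin_SubT_hit:
  assumes "openin (seq_space UNIV) U"
  shows "openin SubT {W \<in> SubV. W \<inter> U \<noteq> {}}"
proof -
  have "openin (chabauty (seq_space UNIV)) {H \<in> closed_subgroups (seq_space UNIV). H \<inter> U \<noteq> {}}"
    unfolding chabauty_def by (rule topology_generated_by_Basis) (use assms in blast)
  moreover have "{W \<in> SubV. W \<inter> U \<noteq> {}} = {H \<in> closed_subgroups (seq_space UNIV). H \<inter> U \<noteq> {}} \<inter> SubV"
    using SubV_subset_closed_subgroups by blast
  ultimately show ?thesis unfolding Sub_topology_def openin_subtopology by blast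
qed

lemma openin_SubT_miss:
  assumes "compactin (seq_space UNIV) K"
  shows "openin SubT {W \<in> SubV. W \<inter> K = {}}"
proof -
  have "openin (chabauty (seq_space UNIV)) {H \<in> closed_subgroups (seq_space UNIV). H \<inter> K = {}}"
    unfolding chabauty_def by (rule topology_generated_by_Basis) (use assms in blast)
  moreover have "{W \<in> SubV. W \<inter> K = {}} = {H \<in> closed_subgroups (seq_space UNIV). H \<inter> K = {}} \<inter> SubV"
    using SubV_subset_closed_subgroups by blast
  ultimately show ?thesis unfolding Sub_topology_def openin_subtopology by blast
qed

lemma borel_open: "openin T U \<Longrightarrow> U \<in> sets (borel_of T)"
  by (simp add: sets_borel_of sigma_sets.Basic)

lemma sets_hit_cylinder: "{W \<in> SubV. z \<in> trunc n ` W} \<in> sets (borel_of SubT)"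
proof -
  have "{W \<in> SubV. z \<in> trunc n ` W} = {W \<in> SubV. W \<inter> {y. trunc n y = z} \<noteq> {}}" by auto
  then show ?thesis using borel_open[OF openin_SubT_hit[OF openin_cylinder]] by simp
qed

text \<open>A single point is compact, so missing it is an open condition and containing it a closed
  one.\<close>

lemma sets_mem: "{W \<in> SubV. v \<in> W} \<in> sets (borel_of SubT)"
proof -
  have "compactin (seq_space UNIV) {v}" by (simp add: finite_imp_compactin)
  then have "{W \<in> SubV. W \<inter> {v} = {}} \<in> sets (borel_of SubT)"
    by (intro borel_open openin_SubT_miss)
  from sets.compl_sets[OF this] have "SubV - {W \<in> SubV. W \<inter> {v} = {}} \<in> sets (borel_of SubT)"
    by (simp only: space_borel_SubT)
  moreover have "SubV - {W \<in> SubV. W \<inter> {v} = {}} = {W \<in> SubV. v \<in> W}" by blast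
  ultimately show ?thesis by (simp only:)
qed

section \<open>Trace events as cylinder sets of the Chabauty space\<close>

definition trace_event :: "nat \<Rightarrow> (nat \<Rightarrow> 'a::field) set \<Rightarrow> (nat \<Rightarrow> 'a) set set" where
  "trace_event n E = {W \<in> SubV. trunc n ` W = E}"

text \<open>Equality of two subsets of the finite space F^n is a finite conjunction of membership
  conditions. The general map \<open>f\<close> covers both the identity and the action of an
  automorphism.\<close>

lemma sets_Collect_trace_eq:
  fixes f :: "'b \<Rightarrow> (nat \<Rightarrow> 'a::{field,finite}) set"
  assumes "\<And>z. {x \<in> space M. z \<in> trunc n ` f x} \<in> sets M"
  shows "{x \<in> space M. trunc n ` f x = E} \<in> sets M"
proof (cases "E \<subseteq> range (trunc n)")
  case True
  then have "{x \<in> space M. trunc n ` f x = E} =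
      {x \<in> space M. \<forall>z\<in>range (trunc n). z \<in> trunc n ` f x \<longleftrightarrow> z \<in> E}"
    by blast
  also have "\<dots> \<in> sets M"
  proof (rule sets.sets_Collect_finite_All[OF _ finite_range_trunc])
    fix z :: "nat \<Rightarrow> 'a"
    have "{x \<in> space M. (z \<in> trunc n ` f x) = (z \<in> E)} =
        (if z \<in> E then {x \<in> space M. z \<in> trunc n ` f x}
         else space M - {x \<in> space M. z \<in> trunc n ` f x})"
      by auto
    then show "{x \<in> space M. (z \<in> trunc n ` f x) = (z \<in> E)} \<in> sets M"
      using assms[of z] by (auto intro: sets.compl_sets)
  qed
  finally show ?thesis .
next
  case False
  then have "{x \<in> space M. trunc n ` f x = E} = {}" by auto
  then show ?thesis by (simp only: sets.empty_sets)
qed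

lemma sets_trace_event: "trace_event n (E :: (nat \<Rightarrow> 'a::{field,finite}) set) \<in> sets (borel_of SubT)"
  using sets_Collect_trace_eq[where M = "borel_of SubT" and f = "\<lambda>W. W" and n = n and E = E,
    unfolded space_borel_SubT, OF sets_hit_cylinder]
  by (simp only: trace_event_def)

lemma trace_event_mono:
  assumes "W \<in> SubV" "m \<le> n"
  shows "trace_event n (trunc n ` W) \<subseteq> trace_event m (trunc m ` W)"
proof -
  have "trunc m ` W' = trunc m ` trunc n ` W'" for W' :: "(nat \<Rightarrow> 'a) set"
    using assms(2) by (simp add: image_image trunc_trunc)
  then show ?thesis by (auto simp: trace_event_def) (metis image_eqI)+
qed

text \<open>Trace events form local bases. Hitting an open set is decided by one cylinder, and
  missing a compact set by finitely many cylinders, so in both cases a finite level suffices;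
  intersections take the larger level.\<close>

lemma trace_event_base:
  fixes W :: "(nat \<Rightarrow> 'a::{field,finite}) set"
  assumes U: "openin SubT U" "W \<in> U"
  shows "\<exists>n. trace_event n (trunc n ` W) \<subseteq> U"
proof -
  have W: "W \<in> SubV" using openin_subset[OF U(1)] U(2) topspace_SubT by blast
  let ?S = "{{H \<in> closed_subgroups (seq_space UNIV). H \<inter> K = {}} | K. compactin (seq_space UNIV) K} \<union>
      {{H \<in> closed_subgroups (seq_space UNIV). H \<inter> U \<noteq> {}} | U. openin (seq_space UNIV) U} ::
      (nat \<Rightarrow> 'a) set set set"
  have gen: "W \<in> X \<Longrightarrow> \<exists>n. trace_event n (trunc n ` W) \<subseteq> X" if "generate_topology_on ?S X" for X
    using that
  proof (induction rule: generate_topology_on.induct)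
    case Empty
    then show ?case by simp
  next
    case (Int a b)
    then obtain m n where mn: "trace_event m (trunc m ` W) \<subseteq> a" "trace_event n (trunc n ` W) \<subseteq> b"
      by blast
    have "trace_event (max m n) (trunc (max m n) ` W) \<subseteq> a \<inter> b"
      using mn trace_event_mono[OF W, of m "max m n"] trace_event_mono[OF W, of n "max m n"] by auto
    then show ?case by blast
  next
    case (UN K)
    then show ?case by (meson Union_iff Union_upper order_trans)
  next
    case (Basis X)
    then consider K where "compactin (seq_space UNIV) K"
        "X = {H \<in> closed_subgroups (seq_space UNIV). H \<inter> K = {}}"
      | G where "openin (seq_space UNIV) G"
        "X = {H \<in> closed_subgroups (seq_space UNIV). H \<inter> G \<noteq> {}}" by blast
    then show ?case
    proof cases
      case (1 K)
      have disj: "W \<inter> K = {}" using 1(2) Basis.prems by blast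
      have "openin (seq_space UNIV) (UNIV - W)"
        using W by (simp add: SubV_iff closedin_def)
      then have "\<forall>x\<in>K. \<exists>n. \<forall>y. trunc n y = trunc n x \<longrightarrow> y \<notin> W"
        using disj unfolding openin_seq_space_UNIV by blast
      then obtain n where n: "\<And>x y. x \<in> K \<Longrightarrow> trunc (n x) y = trunc (n x) x \<Longrightarrow> y \<notin> W" by metis
      \<comment> \<open>Each point of \<open>K\<close> has a cylinder disjoint from the closed set
        \<open>W\<close>; compactness leaves finitely many of them, and \<open>N\<close> exceeds all
        their levels.\<close>
      let ?C = "(\<lambda>x. {y. trunc (n x) y = trunc (n x) x}) ` K"
      have "\<exists>F. finite F \<and> F \<subseteq> ?C \<and> K \<subseteq> \<Union>F"
        using 1(1) unfolding compactin_def
        by (elim conjE allE[of _ ?C]) (auto simp: openin_cylinder)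
      then obtain F where F: "finite F" "F \<subseteq> ?C" "K \<subseteq> \<Union>F" by blast
      then obtain K0 where K0: "K0 \<subseteq> K" "finite K0" "F = (\<lambda>x. {y. trunc (n x) y = trunc (n x) x}) ` K0"
        using finite_subset_image[OF F(1,2)] by blast
      obtain N where N: "\<forall>j\<in>n ` K0. j < N"
        using K0(2) finite_nat_set_iff_bounded by blast
      have "W' \<in> X" if W': "W' \<in> trace_event N (trunc N ` W)" for W'
      proof -
        \<comment> \<open>A common point of \<open>W'\<close> and \<open>K\<close> would agree up to
          level \<open>N\<close> with a point of \<open>W\<close>, placing that point in a cylinder
          disjoint from \<open>W\<close>.\<close>
        have "W' \<inter> K = {}"
        proof (rule ccontr)
          assume "W' \<inter> K \<noteq> {}"
          then obtain y where y: "y \<in> W'" "y \<in> K" by blast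
          then obtain x where x: "x \<in> K0" "trunc (n x) y = trunc (n x) x" using F(3) K0(3) by auto
          have "trunc N y \<in> trunc N ` W" using y W' by (auto simp: trace_event_def)
          then obtain w where w: "w \<in> W" "trunc N w = trunc N y" by (metis imageE)
          have "trunc (n x) w = trunc (n x) y"
            by (rule trunc_eq_mono[OF w(2)]) (use N x in force)
          then show False using n[of x w] x w K0(1) by auto
        qed
        then show ?thesis using W' SubV_subset_closed_subgroups 1(2) by (auto simp: trace_event_def)
      qed
      then show ?thesis by blast
    next
      case (2 G)
      then obtain x where x: "x \<in> W" "x \<in> G" using Basis.prems by blast
      then obtain n where n: "\<And>y. trunc n y = trunc n x \<Longrightarrow> y \<in> G"
        using 2(1) unfolding openin_seq_space_UNIV by blast
      have "W' \<in> X" if W': "W' \<in> trace_event n (trunc n ` W)" for W'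
      proof -
        have "trunc n x \<in> trunc n ` W'" using x W' by (auto simp: trace_event_def)
        then obtain w where "w \<in> W'" "trunc n w = trunc n x" by (metis imageE)
        then show ?thesis using n W' SubV_subset_closed_subgroups 2(2) by (auto simp: trace_event_def)
      qed
      then show ?thesis by blast
    qed
  qed
  obtain X where X: "openin (chabauty (seq_space UNIV)) X" "U = X \<inter> SubV"
    using U(1) unfolding Sub_topology_def openin_subtopology by blast
  have "generate_topology_on ?S X"
    using X(1) unfolding chabauty_def by (rule openin_topology_generated_by)
  then obtain n where "trace_event n (trunc n ` W) \<subseteq> X" using gen U(2) X(2) by blast
  then have "trace_event n (trunc n ` W) \<subseteq> U" using X(2) by (auto simp: trace_event_def)
  then show ?thesis by blast
qed

definition trace_events :: "(nat \<Rightarrow> 'a::field) set set set" where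
  "trace_events = {trace_event n E | n E. True}"

lemma sets_borel_SubT:
  "sets (borel_of SubT) = sigma_sets SubV (trace_events :: (nat \<Rightarrow> 'a::{field,finite}) set set set)"
proof -
  have "sets (borel_of SubT) = sigma_sets (topspace SubT) (trace_events :: (nat \<Rightarrow> 'a) set set set)"
  proof (rule sets_borel_of_countable_base)
    \<comment> \<open>A set \<open>E\<close> not contained in F^n is never a trace, so all such
      \<open>E\<close> contribute only the empty event and countably many events remain.\<close>
    have "trace_events \<subseteq> insert {} (\<Union>n. trace_event n ` Pow (range (trunc n :: (nat \<Rightarrow> 'a) \<Rightarrow> _)))"
      by (auto simp: trace_events_def trace_event_def)
    moreover have "countable (\<Union>n. trace_event n ` Pow (range (trunc n :: (nat \<Rightarrow> 'a) \<Rightarrow> _)))"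
      using finite_range_trunc by (intro countable_UN countable_finite[OF finite_imageI]) (simp_all only: finite_Pow_iff countableI_type)
    ultimately show "countable (trace_events :: (nat \<Rightarrow> 'a) set set set)"
      by (meson countable_insert countable_subset)
    show "trace_events \<subseteq> sets (borel_of (SubT :: (nat \<Rightarrow> 'a) set topology))"
      by (auto simp: trace_events_def sets_trace_event)
    fix U and W :: "(nat \<Rightarrow> 'a) set" assume U: "openin SubT U" "W \<in> U"
    then have "W \<in> SubV" using openin_subset topspace_SubT by blast
    with trace_event_base[OF U] show "\<exists>A\<in>trace_events. W \<in> A \<and> A \<subseteq> U"
      unfolding trace_events_def trace_event_def by blast
  qed
  then show ?thesis by (simp add: topspace_SubT)
qed

text \<open>The trace at a higher level determines the trace at a lower one, so two trace events are
  nested or disjoint.\<close>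

lemma Int_stable_trace_events: "Int_stable (trace_events :: (nat \<Rightarrow> 'a::field) set set set)"
proof (rule Int_stableI)
  have *: "trace_event m E \<inter> trace_event n E' \<in> trace_events" if "m \<le> n"
    for m n and E E' :: "(nat \<Rightarrow> 'a) set"
  proof (cases "trace_event m E \<inter> trace_event n E' = {}")
    case True
    \<comment> \<open>The empty event is itself a trace event: a subspace contains 0, so its trace
      is never empty.\<close>
    have "trace_event 0 {} = ({} :: (nat \<Rightarrow> 'a) set set)"
      by (auto simp: trace_event_def SubV_iff image_iff dest: fs.subspace_0)
    then show ?thesis using True by (auto simp: trace_events_def)
  next
    case False
    then obtain W where W: "W \<in> SubV" "trunc m ` W = E" "trunc n ` W = E'"
      by (auto simp: trace_event_def)
    then have "trace_event n E' \<subseteq> trace_event m E" using trace_event_mono[OF W(1) that] by simp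
    then have "trace_event m E \<inter> trace_event n E' = trace_event n E'" by blast
    then show ?thesis by (auto simp: trace_events_def)
  qed
  fix A B :: "(nat \<Rightarrow> 'a) set set"
  assume "A \<in> trace_events" "B \<in> trace_events"
  then obtain m E n E' where AB: "A = trace_event m E" "B = trace_event n E'"
    by (auto simp: trace_events_def)
  show "A \<inter> B \<in> trace_events"
    using *[of m n E E'] *[of n m E' E] unfolding AB by (cases "m \<le> n") (auto simp: Int_commute)
qed

lemma SubV_eq_trace_event: "SubV = trace_event 0 {0}"
proof -
  have "trunc 0 ` W = {0}" if "W \<in> SubV" for W :: "(nat \<Rightarrow> 'a) set"
    using fs.subspace_0[of W] that by (auto simp: SubV_iff)
  then show ?thesis by (auto simp: trace_event_def)
qed

lemma measure_eqI_trace_events: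
  fixes \<mu> \<nu> :: "(nat \<Rightarrow> 'a::{field,finite}) set measure"
  assumes \<mu>: "prob_space \<mu>" "sets \<mu> = sets (borel_of SubT)"
    and \<nu>: "prob_space \<nu>" "sets \<nu> = sets (borel_of SubT)"
    and eq: "\<And>n E. measure \<mu> (trace_event n E) = measure \<nu> (trace_event n E)"
  shows "\<mu> = \<nu>"
proof (rule measure_eqI_generator_eq[OF Int_stable_trace_events, where \<Omega> = SubV and A = "\<lambda>_. SubV"])
  interpret \<mu>: prob_space \<mu> by fact
  interpret \<nu>: prob_space \<nu> by fact
  show "trace_events \<subseteq> Pow (SubV :: (nat \<Rightarrow> 'a) set set)" by (auto simp: trace_events_def trace_event_def)
  show "sets \<mu> = sigma_sets SubV trace_events" "sets \<nu> = sigma_sets SubV trace_events"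
    using \<mu>(2) \<nu>(2) sets_borel_SubT by auto
  show "emeasure \<mu> X = emeasure \<nu> X" if "X \<in> trace_events" for X
    using that eq by (auto simp: trace_events_def \<mu>.emeasure_eq_measure \<nu>.emeasure_eq_measure)
  show "range (\<lambda>_ :: nat. SubV) \<subseteq> (trace_events :: (nat \<Rightarrow> 'a) set set set)"
    unfolding SubV_eq_trace_event trace_events_def by blast
qed (auto simp: \<mu>(1) prob_space.finite_measure finite_measure.emeasure_finite)

lemma measurable_borel_SubTI:
  fixes f :: "'b \<Rightarrow> (nat \<Rightarrow> 'a::{field,finite}) set"
  assumes "\<And>x. x \<in> space M \<Longrightarrow> f x \<in> SubV"
    and "\<And>n E. {x \<in> space M. trunc n ` f x = E} \<in> sets M"
  shows "f \<in> measurable M (borel_of SubT)"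
proof (rule measurable_sigma_sets[OF sets_borel_SubT])
  show "trace_events \<subseteq> Pow (SubV :: (nat \<Rightarrow> 'a) set set)" by (auto simp: trace_events_def trace_event_def)
  show "f \<in> space M \<rightarrow> SubV" using assms(1) by blast
  fix A :: "(nat \<Rightarrow> 'a) set set" assume "A \<in> trace_events"
  then obtain n E where A: "A = trace_event n E" by (auto simp: trace_events_def)
  have "f -` A \<inter> space M = {x \<in> space M. trunc n ` f x = E}"
    using assms(1) by (auto simp: A trace_event_def)
  then show "f -` A \<inter> space M \<in> sets M" using assms(2) by simp
qed

section \<open>Automorphisms and the zero-one law\<close>

abbreviation AutV :: "((nat \<Rightarrow> 'a::field) \<Rightarrow> nat \<Rightarrow> 'a) set" where
  "AutV \<equiv> Aut fscale (seq_space UNIV)"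

lemma AutD:
  fixes \<phi> :: "(nat \<Rightarrow> 'a::field) \<Rightarrow> nat \<Rightarrow> 'a"
  assumes "\<phi> \<in> AutV"
  shows "bij \<phi>" "lin \<phi>" "continuous_map (seq_space UNIV) (seq_space UNIV) \<phi>"
    "W \<in> SubV \<Longrightarrow> \<phi> ` W \<in> SubV"
proof -
  have hom: "homeomorphic_map (seq_space UNIV) (seq_space UNIV) \<phi>" using assms by (simp add: Aut_def)
  show "bij \<phi>"
    using hom unfolding homeomorphic_eq_everything_map by (simp add: bij_def)
  show lin: "lin \<phi>" using assms by (simp add: Aut_def linear_on_def lin_iff)
  show "continuous_map (seq_space UNIV) (seq_space UNIV) \<phi>"
    using hom by (simp add: homeomorphic_imp_continuous_map)
  show "\<phi> ` W \<in> SubV" if "W \<in> SubV"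
  proof -
    have "closedin (seq_space UNIV) (\<phi> ` W)"
      using homeomorphic_map_closedness_eq[OF hom] that by (simp add: SubV_iff)
    moreover have "fs.subspace (\<phi> ` W)"
      using fsp.linear_subspace_image[OF lin] that by (simp add: SubV_iff)
    ultimately show ?thesis by (simp add: SubV_iff)
  qed
qed

text \<open>The image of \<open>W\<close> hits a cylinder exactly when \<open>W\<close> hits the
  preimage of that cylinder, which is open by continuity.\<close>

lemma measurable_Aut:
  fixes \<phi> :: "(nat \<Rightarrow> 'a::{field,finite}) \<Rightarrow> nat \<Rightarrow> 'a"
  assumes \<phi>: "\<phi> \<in> AutV"
  shows "(\<lambda>W. \<phi> ` W) \<in> measurable (borel_of SubT) (borel_of SubT)"
proof (rule measurable_borel_SubTI)
  show "\<phi> ` W \<in> SubV" if "W \<in> space (borel_of SubT)" for W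
    using AutD(4)[OF \<phi>] that by (simp add: space_borel_SubT)
  show "{W \<in> space (borel_of SubT). trunc n ` \<phi> ` W = E} \<in> sets (borel_of SubT)" for n E
  proof (rule sets_Collect_trace_eq)
    fix z
    have "openin (seq_space UNIV) {x \<in> topspace (seq_space UNIV). \<phi> x \<in> {y. trunc n y = z}}"
      by (rule openin_continuous_map_preimage[OF AutD(3)[OF \<phi>] openin_cylinder])
    then have "{W \<in> SubV. W \<inter> {x. trunc n (\<phi> x) = z} \<noteq> {}} \<in> sets (borel_of SubT)"
      by (intro borel_open openin_SubT_hit) simp
    moreover have "{W \<in> SubV. W \<inter> {x. trunc n (\<phi> x) = z} \<noteq> {}} =
        {W \<in> space (borel_of SubT). z \<in> trunc n ` \<phi> ` W}"
      by (auto simp: space_borel_SubT)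
    ultimately show "{W \<in> space (borel_of SubT). z \<in> trunc n ` \<phi> ` W} \<in> sets (borel_of SubT)" by (simp only:)
  qed
qed

text \<open>A function that reads finitely many coordinates is locally constant; this alone gives
  continuity, whether or not \<open>c\<close> is linear.\<close>

lemma continuous_map_finite_perturbation:
  fixes c :: "(nat \<Rightarrow> 'a::field) \<Rightarrow> nat \<Rightarrow> 'a"
  assumes c: "\<And>x. c (trunc m x) = c x"
  shows "continuous_map (seq_space UNIV) (seq_space UNIV) (\<lambda>x. x + c x)"
  unfolding continuous_map_def
proof (intro conjI allI impI)
  fix U :: "(nat \<Rightarrow> 'a) set" assume U: "openin (seq_space UNIV) U"
  show "openin (seq_space UNIV) {x \<in> topspace (seq_space UNIV). x + c x \<in> U}"
    unfolding openin_seq_space_UNIV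
  proof safe
    fix x assume "x + c x \<in> U"
    then obtain n where n: "\<And>y. trunc n y = trunc n (x + c x) \<Longrightarrow> y \<in> U"
      using U unfolding openin_seq_space_UNIV by blast
    show "\<exists>n. \<forall>y. trunc n y = trunc n x \<longrightarrow> y \<in> {x \<in> topspace (seq_space UNIV). x + c x \<in> U}"
    proof (intro exI[of _ "max n m"] allI impI)
      fix y assume y: "trunc (max n m) y = trunc (max n m) x"
      have "trunc m y = trunc m x" "trunc n y = trunc n x"
        using trunc_eq_mono[OF y] by simp_all
      moreover from this have "c y = c x" using c by metis
      ultimately show "y \<in> {x \<in> topspace (seq_space UNIV). x + c x \<in> U}"
        using n by (simp add: trunc_add)
    qed
  qed
qed simp

text \<open>Since \<open>c\<close> squares to zero, the inverse of 1 + c is 1 - c, and both are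
  continuous as perturbations that read finitely many coordinates.\<close>

lemma shear_in_Aut:
  fixes c :: "(nat \<Rightarrow> 'a::field) \<Rightarrow> nat \<Rightarrow> 'a"
  assumes c: "lin c" "\<And>x. c (c x) = 0" "\<And>x. c (trunc m x) = c x"
  shows "(\<lambda>x. x + c x) \<in> AutV"
proof -
  have "homeomorphic_maps (seq_space UNIV) (seq_space UNIV) (\<lambda>x. x + c x) (\<lambda>x. x + - c x)"
    unfolding homeomorphic_maps_def
  proof (intro conjI ballI)
    show "continuous_map (seq_space UNIV) (seq_space UNIV) (\<lambda>x. x + c x)"
      "continuous_map (seq_space UNIV) (seq_space UNIV) (\<lambda>x. x + - c x)"
      by (rule continuous_map_finite_perturbation[of _ m], simp add: c(3))+
    have "c (x + c x) = c x" "c (x + - c x) = c x" for x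
      using c(1,2) lin_diff[OF c(1), of x "c x"] by (simp_all add: lin_iff)
    then show "x + c x + - c (x + c x) = x" "x + - c x + c (x + - c x) = x" for x by simp_all
  qed
  then have "homeomorphic_map (seq_space UNIV) (seq_space UNIV) (\<lambda>x. x + c x)"
    by (rule homeomorphic_maps_imp_map)
  then show ?thesis
    by (auto simp: Aut_def intro!: lin_imp_linear_on lin_add lin_id c(1))
qed

lemma Lin_window_shear_in_Aut:
  assumes b: "b \<in> Lin (window n m) (trunc n)"
  shows "(\<lambda>x. x + b x) \<in> AutV"
proof (rule shear_in_Aut[where m = m])
  show "lin b" using LinD(1)[OF b] .
  show "b (b x) = 0" for x
  proof -
    \<comment> \<open>The map \<open>b\<close> writes into coordinates below \<open>n\<close> and
      reads coordinates from \<open>n\<close> on, so it squares to zero.\<close>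
    have "window n m (trunc n (b x)) = 0" by (auto simp: window_def trunc_def fun_eq_iff)
    then have "window n m (b x) = 0" by (simp only: LinD(3)[OF b])
    then show ?thesis using LinD(2)[OF b, of "b x"] lin_0[OF LinD(1)[OF b]] by simp
  qed
  have "window n m (trunc m x) = window n m x" for x :: "nat \<Rightarrow> 'a"
    by (auto simp: window_def trunc_def)
  then show "b (trunc m x) = b x" for x using LinD(2)[OF b] by metis
qed

abbreviation CRSV :: "(nat \<Rightarrow> 'a::field) set measure set" where
  "CRSV \<equiv> CRS fscale (seq_space UNIV)"

lemma CRS_measure_image:
  fixes \<mu> :: "(nat \<Rightarrow> 'a::{field,finite}) set measure"
  assumes \<mu>: "\<mu> \<in> CRSV" and \<phi>: "\<phi> \<in> AutV" and A: "A \<in> sets (borel_of SubT)"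
  shows "measure \<mu> {W \<in> SubV. \<phi> ` W \<in> A} = measure \<mu> A"
proof -
  have sets: "sets \<mu> = sets (borel_of SubT)" and inv: "distr \<mu> (borel_of SubT) (\<lambda>W. \<phi> ` W) = \<mu>"
    using \<mu> \<phi> by (auto simp: CRS_def)
  have "(\<lambda>W. \<phi> ` W) \<in> measurable \<mu> (borel_of SubT)"
    using measurable_Aut[OF \<phi>] by (simp add: measurable_cong_sets[OF sets refl])
  then have "measure (distr \<mu> (borel_of SubT) (\<lambda>W. \<phi> ` W)) A = measure \<mu> ((\<lambda>W. \<phi> ` W) -` A \<inter> space \<mu>)"
    using A by (rule measure_distr)
  moreover have "space \<mu> = SubV" using sets_eq_imp_space_eq[OF sets] by (simp add: space_borel_SubT)
  ultimately show ?thesis unfolding inv by (simp add: vimage_def Int_def conj_commute)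
qed

text \<open>Conditioning an invariant law on an invariant event of positive probability keeps it
  invariant, because the preimage of \<open>A \<inter> B\<close> is \<open>A\<close> intersected
  with the preimage of \<open>B\<close>.\<close>

lemma CRS_uniform_measure:
  fixes \<mu> :: "(nat \<Rightarrow> 'a::{field,finite}) set measure"
  assumes \<mu>: "\<mu> \<in> CRSV" and A: "A \<in> sets (borel_of SubT)" "measure \<mu> A > 0"
    and inv: "\<And>\<phi> W. \<phi> \<in> AutV \<Longrightarrow> W \<in> SubV \<Longrightarrow> \<phi> ` W \<in> A \<longleftrightarrow> W \<in> A"
  shows "uniform_measure \<mu> A \<in> CRSV"
proof -
  interpret prob_space \<mu> using \<mu> by (simp add: CRS_def)
  have sets: "sets \<mu> = sets (borel_of SubT)" using \<mu> by (simp add: CRS_def)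
  have space: "space \<mu> = SubV" using sets_eq_imp_space_eq[OF sets] by (simp add: space_borel_SubT)
  have pos: "emeasure \<mu> A \<noteq> 0" using A(2) by (simp add: emeasure_eq_measure)
  have "distr (uniform_measure \<mu> A) (borel_of SubT) (\<lambda>W. \<phi> ` W) = uniform_measure \<mu> A"
    if \<phi>: "\<phi> \<in> AutV" for \<phi>
  proof (rule measure_eqI)
    show "sets (distr (uniform_measure \<mu> A) (borel_of SubT) (\<lambda>W. \<phi> ` W)) = sets (uniform_measure \<mu> A)"
      by (simp add: sets)
    fix B assume "B \<in> sets (distr (uniform_measure \<mu> A) (borel_of SubT) (\<lambda>W. \<phi> ` W))"
    then have B: "B \<in> sets (borel_of SubT)" by simp
    have meas: "(\<lambda>W. \<phi> ` W) \<in> measurable \<mu> (borel_of SubT)"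
      using measurable_Aut[OF \<phi>] by (simp add: measurable_cong_sets[OF sets refl])
    have pre: "(\<lambda>W. \<phi> ` W) -` B \<inter> space \<mu> \<in> sets \<mu>" by (rule measurable_sets[OF meas B])
    have "emeasure (distr (uniform_measure \<mu> A) (borel_of SubT) (\<lambda>W. \<phi> ` W)) B =
        emeasure (uniform_measure \<mu> A) ((\<lambda>W. \<phi> ` W) -` B \<inter> space \<mu>)"
      using meas B by (subst emeasure_distr) (auto simp: measurable_cong_sets[OF sets_uniform_measure refl])
    also have "\<dots> = emeasure \<mu> (A \<inter> ((\<lambda>W. \<phi> ` W) -` B \<inter> space \<mu>)) / emeasure \<mu> A"
      using A pre by (simp add: sets)
    also have "A \<inter> ((\<lambda>W. \<phi> ` W) -` B \<inter> space \<mu>) = {W \<in> SubV. \<phi> ` W \<in> A \<inter> B}"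
      using inv[OF \<phi>] sets.sets_into_space[OF A(1)] by (auto simp: space space_borel_SubT)
    also have "emeasure \<mu> \<dots> = emeasure \<mu> (A \<inter> B)"
      using CRS_measure_image[OF \<mu> \<phi>, of "A \<inter> B"] A(1) B by (simp add: emeasure_eq_measure)
    also have "\<dots> / emeasure \<mu> A = emeasure (uniform_measure \<mu> A) B"
      using A B by (simp add: sets)
    finally show "emeasure (distr (uniform_measure \<mu> A) (borel_of SubT) (\<lambda>W. \<phi> ` W)) B =
      emeasure (uniform_measure \<mu> A) B" .
  qed
  moreover have "prob_space (uniform_measure \<mu> A)"
    using pos by (intro prob_space_uniform_measure) auto
  ultimately show ?thesis by (simp add: CRS_def sets)
qed

text \<open>If \<open>A\<close> had probability strictly between 0 and 1, conditioning on
  \<open>A\<close> and on its complement would write \<mu> as a proper convex combination.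
  Extremality would make the two conditional laws equal, but they give \<open>A\<close> the masses 1
  and 0.\<close>

lemma CRSe_zero_one:
  fixes \<mu> :: "(nat \<Rightarrow> 'a::{field,finite}) set measure"
  assumes \<mu>: "\<mu> \<in> CRSe fscale (seq_space UNIV)" and A: "A \<in> sets (borel_of SubT)"
    and inv: "\<And>\<phi> W. \<phi> \<in> AutV \<Longrightarrow> W \<in> SubV \<Longrightarrow> \<phi> ` W \<in> A \<longleftrightarrow> W \<in> A"
  shows "measure \<mu> A = 0 \<or> measure \<mu> A = 1"
proof (rule ccontr)
  assume *: "\<not> ?thesis"
  have CRS: "\<mu> \<in> CRSV" using \<mu> by (simp add: CRSe_def extreme_measures_def)
  interpret prob_space \<mu> using CRS by (simp add: CRS_def)
  have sets: "sets \<mu> = sets (borel_of SubT)" using CRS by (simp add: CRS_def)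
  have space: "space \<mu> = SubV" using sets_eq_imp_space_eq[OF sets] by (simp add: space_borel_SubT)
  define t where "t = measure \<mu> A"
  have t: "0 < t" "t < 1" using * prob_le_1[of A] unfolding t_def by (auto simp: zero_less_measure_iff simp del: prob_le_1)
  let ?A' = "space \<mu> - A"
  have A': "?A' \<in> sets (borel_of SubT)" "measure \<mu> ?A' = 1 - t"
    using A sets by (auto simp: t_def prob_compl)
  have "uniform_measure \<mu> A \<in> CRSV"
    by (rule CRS_uniform_measure[OF CRS A]) (use t inv in \<open>auto simp: t_def\<close>)
  moreover have "uniform_measure \<mu> ?A' \<in> CRSV"
    by (rule CRS_uniform_measure[OF CRS A'(1)]) (use t inv A' AutD(4) in \<open>auto simp: space\<close>)
  moreover have "measure \<mu> B = (1 - t) * measure (uniform_measure \<mu> ?A') B + t * measure (uniform_measure \<mu> A) B"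
    if B: "B \<in> sets \<mu>" for B
  proof -
    have u: "measure (uniform_measure \<mu> C) B = measure \<mu> (C \<inter> B) / measure \<mu> C"
      if "C \<in> sets \<mu>" "measure \<mu> C > 0" for C
      using that B by (intro measure_uniform_measure) (auto simp: emeasure_eq_measure)
    have "?A' \<inter> B = B - A" using sets.sets_into_space[OF B] by blast
    then have "measure \<mu> (?A' \<inter> B) = measure \<mu> B - measure \<mu> (A \<inter> B)"
      using finite_measure_Diff'[of B A] A B sets by (simp add: Int_commute)
    then show ?thesis using u[of A] u[of ?A'] A A' t sets by (simp add: t_def)
  qed
  ultimately have eq: "uniform_measure \<mu> ?A' = uniform_measure \<mu> A"
    using \<mu> t unfolding CRSe_def extreme_measures_def by blast
  have "emeasure (uniform_measure \<mu> ?A') A = 0" "emeasure (uniform_measure \<mu> A) A = 1"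
    using A A' t sets by (auto simp: emeasure_eq_measure t_def Int_commute[of _ A])
  then show False by (simp add: eq)
qed

section \<open>The cardinality of an extremal random subspace\<close>

text \<open>Finitely many distinct sequences are already distinguished by finitely many coordinates.
  This expresses the cardinality of \<open>W\<close> through its traces and so makes it
  measurable.\<close>

lemma finite_card_le_iff_trunc:
  fixes W :: "(nat \<Rightarrow> 'a::{field,finite}) set"
  shows "finite W \<and> card W \<le> m \<longleftrightarrow> (\<forall>n. card (trunc n ` W) \<le> m)"
proof
  assume "finite W \<and> card W \<le> m"
  then show "\<forall>n. card (trunc n ` W) \<le> m" using card_image_le order_trans by blast
next
  assume *: "\<forall>n. card (trunc n ` W) \<le> m"
  show "finite W \<and> card W \<le> m"
  proof (rule ccontr)
    assume "\<not> (finite W \<and> card W \<le> m)"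
    \<comment> \<open>Such a subset exists both when \<open>W\<close> is infinite and when it is
      finite but too large.\<close>
    then obtain S where S: "S \<subseteq> W" "finite S" "card S = Suc m"
      by (metis infinite_arbitrarily_large not_less_eq_eq obtain_subset_with_card_n)
    have "\<forall>x y. \<exists>i. x \<noteq> y \<longrightarrow> x i \<noteq> (y i :: 'a)" by (metis ext)
    then obtain i :: "(nat \<Rightarrow> 'a) \<Rightarrow> (nat \<Rightarrow> 'a) \<Rightarrow> nat" where i: "\<And>x y. x \<noteq> y \<Longrightarrow> x (i x y) \<noteq> (y (i x y) :: 'a)" by metis
    have "finite ((\<lambda>(x, y). i x y) ` (S \<times> S))" using S(2) by blast
    then obtain n where n: "\<forall>j\<in>(\<lambda>(x, y). i x y) ` (S \<times> S). j < n"
      using finite_nat_set_iff_bounded by blast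
    have "inj_on (trunc n) S"
    proof (rule inj_onI, rule ccontr)
      fix x y assume xy: "x \<in> S" "y \<in> S" "trunc n x = trunc n y" "x \<noteq> y"
      then have "i x y < n" using n by auto
      then show False using i[OF xy(4)] xy(3) by (simp add: trunc_eq_iff)
    qed
    then have "card (trunc n ` S) = Suc m" using S(3) by (simp add: card_image)
    moreover have "card (trunc n ` S) \<le> card (trunc n ` W)"
      by (rule card_mono[OF finite_subset[OF _ finite_range_trunc]]) (use S(1) in auto)
    ultimately show False using * by (metis not_less_eq_eq)
  qed
qed

lemma sets_finite_card_le:
  "{W \<in> SubV. finite W \<and> card W \<le> m} \<in> sets (borel_of (SubT :: (nat \<Rightarrow> 'a::{field,finite}) set topology))"
proof -
  have "{W \<in> SubV. finite W \<and> card W \<le> m} =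
      (\<Inter>n. \<Union>E\<in>{E \<in> Pow (range (trunc n)). card E \<le> m}. trace_event n (E :: (nat \<Rightarrow> 'a) set))"
  proof -
    have "(\<Union>E\<in>{E \<in> Pow (range (trunc n)). card E \<le> m}. trace_event n E) =
        {W \<in> SubV :: (nat \<Rightarrow> 'a) set set. card (trunc n ` W) \<le> m}" for n
      unfolding trace_event_def by auto
    then show ?thesis by (simp only: finite_card_le_iff_trunc) auto
  qed
  also have "\<dots> \<in> sets (borel_of SubT)"
  proof (rule sets.countable_INT)
    show "range (\<lambda>n. \<Union>E\<in>{E \<in> Pow (range (trunc n)). card E \<le> m}. trace_event n (E :: (nat \<Rightarrow> 'a) set))
      \<subseteq> sets (borel_of SubT)"
    proof (intro image_subsetI sets.finite_UN sets_trace_event)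
      fix n
      have "finite (Pow (range (trunc n :: (nat \<Rightarrow> 'a) \<Rightarrow> _)))"
        by (simp only: finite_Pow_iff finite_range_trunc)
      then show "finite {E \<in> Pow (range (trunc n :: (nat \<Rightarrow> 'a) \<Rightarrow> _)). card E \<le> m}"
        by (rule finite_subset[rotated]) auto
    qed
  qed simp
  finally show ?thesis .
qed

text \<open>A subspace contains 0, so \<open>card W = 0\<close> occurs only as the default value of
  \<open>card\<close> on infinite sets; that event is the complement of all finite ones. For
  positive \<open>m\<close> a difference of two bounds on the cardinality is taken.\<close>

lemma sets_card_eq:
  "{W \<in> SubV. card W = m} \<in> sets (borel_of (SubT :: (nat \<Rightarrow> 'a::{field,finite}) set topology))"
proof (cases "m = 0")
  case True
  have "card W = 0 \<longleftrightarrow> infinite W" if "W \<in> SubV" for W :: "(nat \<Rightarrow> 'a) set"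
    using fs.subspace_0[of W] that by (auto simp: SubV_iff card_eq_0_iff)
  then have "{W \<in> SubV. card W = m} =
      space (borel_of SubT) - (\<Union>m. {W \<in> SubV :: (nat \<Rightarrow> 'a) set set. finite W \<and> card W \<le> m})"
    using True by (auto simp: space_borel_SubT)
  also have "\<dots> \<in> sets (borel_of SubT)"
    by (intro sets.compl_sets sets.countable_UN image_subsetI sets_finite_card_le)
  finally show ?thesis .
next
  case False
  then have "{W \<in> SubV. card W = m} =
      {W \<in> SubV :: (nat \<Rightarrow> 'a) set set. finite W \<and> card W \<le> m} -
      {W \<in> SubV. finite W \<and> card W \<le> m - 1}"
    by (auto intro: card_ge_0_finite)
  also have "\<dots> \<in> sets (borel_of SubT)" by (intro sets.Diff sets_finite_card_le)
  finally show ?thesis .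
qed

text \<open>The case \<open>m = 0\<close> is that of infinite subspaces.\<close>

lemma CRSe_AE_card:
  fixes \<mu> :: "(nat \<Rightarrow> 'a::{field,finite}) set measure"
  assumes \<mu>: "\<mu> \<in> CRSe fscale (seq_space UNIV)"
  obtains m where "AE W in \<mu>. card W = m"
proof -
  have CRS: "\<mu> \<in> CRSV" using \<mu> by (simp add: CRSe_def extreme_measures_def)
  interpret prob_space \<mu> using CRS by (simp add: CRS_def)
  have sets: "sets \<mu> = sets (borel_of SubT)" using CRS by (simp add: CRS_def)
  have space: "space \<mu> = SubV" using sets_eq_imp_space_eq[OF sets] by (simp add: space_borel_SubT)
  have zo: "measure \<mu> {W \<in> SubV. card W = m} = 0 \<or> measure \<mu> {W \<in> SubV. card W = m} = 1" for m
  proof (rule CRSe_zero_one[OF \<mu> sets_card_eq])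
    fix \<phi> :: "(nat \<Rightarrow> 'a) \<Rightarrow> nat \<Rightarrow> 'a" and W :: "(nat \<Rightarrow> 'a) set"
    assume \<phi>: "\<phi> \<in> AutV" and "W \<in> SubV"
    moreover have "inj_on \<phi> W" using AutD(1)[OF \<phi>] by (auto simp: bij_def intro: inj_on_subset)
    ultimately show "\<phi> ` W \<in> {W \<in> SubV. card W = m} \<longleftrightarrow> W \<in> {W \<in> SubV. card W = m}"
      using AutD(4)[OF \<phi>] by (simp add: card_image)
  qed
  \<comment> \<open>The countably many values of \<open>card\<close> cover the whole space, so their
    events cannot all be null.\<close>
  have "\<exists>m. measure \<mu> {W \<in> SubV. card W = m} = 1"
  proof (rule ccontr)
    assume "\<not> ?thesis"
    then have "emeasure \<mu> {W \<in> SubV. card W = m} = 0" for m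
      using zo by (simp add: emeasure_eq_measure)
    then have "emeasure \<mu> (\<Union>m. {W \<in> SubV. card W = m}) = 0"
      by (intro emeasure_UN_eq_0) (auto simp: sets sets_card_eq)
    moreover have "(\<Union>m. {W \<in> SubV. card W = m}) = space \<mu>" by (auto simp: space)
    ultimately show False by (simp add: emeasure_space_1)
  qed
  then obtain m where "measure \<mu> {W \<in> SubV. card W = m} = 1" by blast
  then have "AE W in \<mu>. W \<in> {W \<in> SubV. card W = m}"
    using sets_card_eq[of m] by (intro AE_prob_1) auto
  then have "AE W in \<mu>. card W = m" by eventually_elim simp
  then show ?thesis by (rule that)
qed

text \<open>
  A nonzero vector has infinitely many images under automorphisms, and a random subspace of bounded
  size cannot contain each of them with the same positive probability.
\<close>

lemma CRS_AE_not_mem: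
  fixes \<mu> :: "(nat \<Rightarrow> 'a::{field,finite}) set measure"
  assumes CRS: "\<mu> \<in> CRSV" and m: "AE W in \<mu>. card W = m" "m > 0" and v: "v \<noteq> 0"
  shows "AE W in \<mu>. v \<notin> W"
proof -
  interpret prob_space \<mu> using CRS by (simp add: CRS_def)
  have sets: "sets \<mu> = sets (borel_of SubT)" using CRS by (simp add: CRS_def)
  have space: "space \<mu> = SubV" using sets_eq_imp_space_eq[OF sets] by (simp add: space_borel_SubT)
  obtain i where i: "v i \<noteq> 0" using v by (auto simp: fun_eq_iff)
  define p where "p = measure \<mu> {W \<in> SubV. v \<in> W}"
  have p: "measure \<mu> {W \<in> SubV. v + unit_seq j \<in> W} = p" if j: "j \<noteq> i" for j
  proof -
    \<comment> \<open>A transvection that moves \<open>v\<close> to \<open>v + unit_seq j\<close>.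
      It reads only coordinate \<open>i\<close>, where \<open>v\<close> is nonzero, and writes only
      to coordinate \<open>j\<close>, so it squares to zero when
      \<open>j \<noteq> i\<close>.\<close>
    define c :: "(nat \<Rightarrow> 'a) \<Rightarrow> nat \<Rightarrow> 'a" where "c x = fscale (x i / v i) (unit_seq j)" for x
    have \<phi>: "(\<lambda>x. x + c x) \<in> AutV"
    proof (rule shear_in_Aut[where m = "Suc i"])
      show "lin c" by (auto simp: lin_iff c_def fscale_def fun_eq_iff add_divide_distrib algebra_simps)
      show "c (c x) = 0" for x using j by (auto simp: c_def fscale_def unit_seq_def fun_eq_iff)
      show "c (trunc (Suc i) x) = c x" for x by (simp add: c_def trunc_def)
    qed
    have cv: "v + c v = v + unit_seq j" using i by (simp add: c_def)
    have "v + unit_seq j \<in> (\<lambda>x. x + c x) ` W \<longleftrightarrow> v \<in> W" for W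
      using inj_image_mem_iff[OF bij_is_inj[OF AutD(1)[OF \<phi>]], of v W] by (simp add: cv)
    then have "{W \<in> SubV. (\<lambda>x. x + c x) ` W \<in> {W \<in> SubV. v + unit_seq j \<in> W}} = {W \<in> SubV. v \<in> W}"
      using AutD(4)[OF \<phi>] by blast
    then show ?thesis
      using CRS_measure_image[OF CRS \<phi> sets_mem[of "v + unit_seq j"]] by (simp add: p_def)
  qed
  have bound: "real L * p \<le> real m" for L :: nat
  proof -
    \<comment> \<open>There are \<open>L\<close> indices, all beyond \<open>i\<close>. The expected
      number of the \<open>L\<close> distinct vectors contained in \<open>W\<close> is
      \<open>L * p\<close>, yet this number never exceeds the size of \<open>W\<close>.\<close>
    let ?J = "{i<..i + L}"
    let ?f = "\<lambda>W. \<Sum>j\<in>?J. indicator {W \<in> SubV. v + unit_seq j \<in> W} W :: real"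
    have int: "integrable \<mu> (indicator {W \<in> SubV. v + unit_seq j \<in> W} :: _ \<Rightarrow> real)" for j
      using sets_mem[of "v + unit_seq j"] by (simp add: sets emeasure_eq_measure)
    have "real L * p = (\<Sum>j\<in>?J. measure \<mu> {W \<in> SubV. v + unit_seq j \<in> W})"
      using p by simp
    also have "\<dots> = (\<integral>W. ?f W \<partial>\<mu>)"
      using int by (simp add: Bochner_Integration.integral_sum Int_absorb2 space)
    also have "\<dots> \<le> (\<integral>W. real m \<partial>\<mu>)"
    proof (rule integral_mono_AE)
      show "integrable \<mu> ?f" using int by (intro Bochner_Integration.integrable_sum)
      show "AE W in \<mu>. ?f W \<le> real m"
        using m(1)
      proof eventually_elim
        case (elim W)
        have "finite W" using elim m(2) card_ge_0_finite by blast
        have inj: "inj_on (\<lambda>j. v + unit_seq j) ?J"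
          by (rule inj_onI) (metis add_left_cancel unit_seq_def zero_neq_one)
        have "?f W \<le> (\<Sum>j\<in>?J. if v + unit_seq j \<in> W then 1 else 0)"
          by (intro sum_mono) (auto simp: indicator_def)
        also have "\<dots> = real (card {j \<in> ?J. v + unit_seq j \<in> W})"
          by (simp add: sum.If_cases Int_def)
        also have "\<dots> \<le> real (card W)"
          using \<open>finite W\<close> inj
          by (intro of_nat_mono card_inj_on_le[where f = "\<lambda>j. v + unit_seq j"])
            (auto intro: inj_on_subset)
        finally show ?case using elim by simp
      qed
    qed simp
    finally show ?thesis by (simp add: prob_space)
  qed
  have "p = 0"
  proof (rule ccontr)
    assume "p \<noteq> 0"
    then have "p > 0" by (simp add: p_def zero_less_measure_iff)
    then obtain L :: nat where "real L * p > real m" using reals_Archimedean3 by blast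
    then show False using bound[of L] by simp
  qed
  then have "{W \<in> SubV. v \<in> W} \<in> null_sets \<mu>"
    using sets_mem[of v] by (simp add: null_sets_def sets emeasure_eq_measure p_def)
  then have "AE W in \<mu>. W \<notin> {W \<in> SubV. v \<in> W}" by (rule AE_not_in)
  with AE_space show ?thesis by eventually_elim (simp add: space)
qed

section \<open>Averaging over random shears\<close>

text \<open>For every \<open>m\<close>, the proportion of shears carrying \<open>W\<close> into
  \<open>A\<close> has expectation \<open>measure \<mu> A\<close>, since each shear preserves \<mu>.
  Proportions are bounded by 1, so dominated convergence reduces the computation of a probability to
  counting shears for an individual \<open>W\<close>.\<close>

lemma CRS_measure_eq_limit:
  fixes \<mu> :: "(nat \<Rightarrow> 'a::{field,finite}) set measure"
  assumes CRS: "\<mu> \<in> CRSV" and A: "A \<in> sets (borel_of SubT)"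
    and lim: "AE W in \<mu>. (\<lambda>m. real (card {b \<in> Lin (window n m) (trunc n). (\<lambda>x. x + b x) ` W \<in> A}) /
      real (card (Lin (window n m) (trunc n) :: ((nat \<Rightarrow> 'a) \<Rightarrow> _) set))) \<longlonglongrightarrow> r"
  shows "measure \<mu> A = r"
proof -
  interpret prob_space \<mu> using CRS by (simp add: CRS_def)
  have sets: "sets \<mu> = sets (borel_of SubT)" using CRS by (simp add: CRS_def)
  have space: "space \<mu> = SubV" using sets_eq_imp_space_eq[OF sets] by (simp add: space_borel_SubT)
  define B where "B m = (Lin (window n m) (trunc n) :: ((nat \<Rightarrow> 'a) \<Rightarrow> _) set)" for m
  define P where "P b = {W \<in> SubV. (\<lambda>x. x + b x) ` W \<in> A}" for b :: "(nat \<Rightarrow> 'a) \<Rightarrow> _"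
  define f where "f m W = (\<Sum>b\<in>B m. indicator (P b) W) / real (card (B m))" for m W
  have fin: "finite (B m)" for m
    unfolding B_def by (intro finite_Lin finite_range_window finite_range_trunc)
  have ne: "B m \<noteq> {}" for m unfolding B_def using Lin_zero[OF lin_trunc] by blast
  have f: "f m W = real (card {b \<in> B m. (\<lambda>x. x + b x) ` W \<in> A}) / real (card (B m))"
    if "W \<in> SubV" for m W
  proof -
    have "(\<Sum>b\<in>B m. indicator (P b) W :: real) = (\<Sum>b\<in>B m. if (\<lambda>x. x + b x) ` W \<in> A then 1 else 0)"
      using that by (intro sum.cong) (auto simp: P_def)
    also have "\<dots> = real (card {b \<in> B m. (\<lambda>x. x + b x) ` W \<in> A})"
      using fin by (simp add: sum.If_cases Int_def)
    finally show ?thesis by (simp add: f_def)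
  qed
  have PB: "P b \<in> sets \<mu>" "measure \<mu> (P b) = measure \<mu> A" if "b \<in> B m" for b m
  proof -
    have \<phi>: "(\<lambda>x. x + b x) \<in> AutV" using that unfolding B_def by (rule Lin_window_shear_in_Aut)
    have "P b = (\<lambda>W. (\<lambda>x. x + b x) ` W) -` A \<inter> space (borel_of SubT)"
      by (auto simp: P_def space_borel_SubT)
    then show "P b \<in> sets \<mu>" using measurable_sets[OF measurable_Aut[OF \<phi>] A] by (simp add: sets)
    show "measure \<mu> (P b) = measure \<mu> A" unfolding P_def by (rule CRS_measure_image[OF CRS \<phi> A])
  qed
  have int: "(\<integral>W. f m W \<partial>\<mu>) = measure \<mu> A" for m
  proof -
    have "(\<integral>W. f m W \<partial>\<mu>) = (\<Sum>b\<in>B m. (\<integral>W. indicator (P b) W \<partial>\<mu>)) / real (card (B m))"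
      unfolding f_def using PB(1)[of _ m]
      by (subst Bochner_Integration.integral_divide_zero, subst Bochner_Integration.integral_sum)
        (auto simp: emeasure_eq_measure)
    also have "\<dots> = (\<Sum>b\<in>B m. measure \<mu> A) / real (card (B m))"
      using PB sets.sets_into_space by (intro arg_cong2[where f = "(/)"] sum.cong refl)
        (auto simp: Int_absorb2)
    finally show ?thesis using fin ne by simp
  qed
  have meas: "f m \<in> borel_measurable \<mu>" for m
    unfolding f_def using PB(1)[of _ m] by (intro borel_measurable_divide borel_measurable_sum) auto
  have "(\<lambda>m. \<integral>W. f m W \<partial>\<mu>) \<longlonglongrightarrow> (\<integral>W. r \<partial>\<mu>)"
  proof (rule integral_dominated_convergence[where w = "\<lambda>_. 1"])
    show "AE W in \<mu>. (\<lambda>m. f m W) \<longlonglongrightarrow> r"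
      using lim AE_space by eventually_elim (simp add: f space B_def)
    show "AE W in \<mu>. norm (f m W) \<le> 1" for m
      using AE_space
    proof eventually_elim
      case (elim W)
      have "card {b \<in> B m. (\<lambda>x. x + b x) ` W \<in> A} \<le> card (B m)"
        using fin by (intro card_mono) auto
      then show ?case using elim fin ne by (simp add: f space divide_le_eq_1 card_gt_0_iff)
    qed
  qed (use meas in auto)
  then have "(\<lambda>m. measure \<mu> A) \<longlonglongrightarrow> r" by (simp add: int prob_space)
  then show ?thesis using LIMSEQ_unique tendsto_const by blast
qed

text \<open>The right-hand side does not depend on \<mu>: among invariant laws, the almost sure
  cardinality already fixes all probabilities at finite levels.\<close>

lemma CRS_measure_trace_event:
  fixes \<mu> :: "(nat \<Rightarrow> 'a::{field,finite}) set measure"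
  assumes CRS: "\<mu> \<in> CRSV" and card: "AE W in \<mu>. card W = CARD('a) ^ k"
  shows "measure \<mu> (trace_event n E) =
    real (card {g \<in> Lin (trunc k) (trunc n). range g = E}) /
    real (card (Lin (trunc k) (trunc n) :: ((nat \<Rightarrow> 'a) \<Rightarrow> _) set))"
proof (rule CRS_measure_eq_limit[OF CRS sets_trace_event, where n = n])
  have sets: "sets \<mu> = sets (borel_of SubT)" using CRS by (simp add: CRS_def)
  have space: "space \<mu> = SubV" using sets_eq_imp_space_eq[OF sets] by (simp add: space_borel_SubT)
  note q = CARD_field_gt_1[where 'a = 'a]
  let ?L = "Lin (trunc k) (trunc n) :: ((nat \<Rightarrow> 'a) \<Rightarrow> _) set"
  have "finite (range (trunc n) - {0 :: nat \<Rightarrow> 'a})" by (intro finite_Diff finite_range_trunc)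
  \<comment> \<open>F^n is finite, so its nonzero vectors can be excluded simultaneously on one
    almost sure event.\<close>
  then have "AE W in \<mu>. \<forall>v\<in>range (trunc n) - {0}. v \<notin> W"
    by (rule AE_finite_allI) (use q in \<open>auto intro: CRS_AE_not_mem[OF CRS card]\<close>)
  with card AE_space show "AE W in \<mu>.
      (\<lambda>m. real (card {b \<in> Lin (window n m) (trunc n). (\<lambda>x. x + b x) ` W \<in> trace_event n E}) /
        real (card (Lin (window n m) (trunc n) :: ((nat \<Rightarrow> 'a) \<Rightarrow> _) set)))
      \<longlonglongrightarrow> real (card {g \<in> ?L. range g = E}) / real (card ?L)"
  proof eventually_elim
    case (elim W)
    have W: "W \<in> SubV" "fs.subspace W" using elim by (simp_all add: space SubV_iff)
    have fin: "finite W" using elim q by (intro card_ge_0_finite) simp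
    obtain k' \<psi> where \<psi>0: "embeds k' \<psi> W {0}" "range \<psi> = W" using embeds_finite[OF W(2) fin] by blast
    have "CARD('a) ^ k' = CARD('a) ^ k" using embeds_card[OF \<psi>0(1)] \<psi>0(2) elim by simp
    then have "k' = k" using q by (simp add: power_inject_exp)
    with \<psi>0 have \<psi>: "lin \<psi>" "\<And>x. \<psi> (trunc k x) = \<psi> x" "range \<psi> = W" "\<And>x. \<psi> x = 0 \<Longrightarrow> trunc k x = 0"
      by (auto simp: embeds_def)
    \<comment> \<open>Since \<open>W\<close> meets F^n only in 0, injectivity of the parametrization
      is the same as injectivity modulo F^n.\<close>
    have "embeds k \<psi> W (range (trunc n))"
      unfolding embeds_def
    proof (intro conjI allI impI)
      fix x assume "\<psi> x \<in> range (trunc n)"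
      moreover have "\<psi> x \<in> W" using \<psi>(3) by blast
      ultimately have "\<psi> x = 0" using elim(3) by blast
      then show "trunc k x = 0" by (rule \<psi>(4))
    qed (use \<psi> in auto)
    \<comment> \<open>Once the window is long enough for this \<open>W\<close>, the proportion
      equals the limit exactly. The threshold depends on \<open>W\<close>, so the equality holds for
      each \<open>W\<close> separately and not uniformly.\<close>
    from embeds_eventually_window[OF this] have "\<forall>\<^sub>F m in sequentially.
        real (card {b \<in> Lin (window n m) (trunc n). (\<lambda>x. x + b x) ` W \<in> trace_event n E}) /
          real (card (Lin (window n m) (trunc n) :: ((nat \<Rightarrow> 'a) \<Rightarrow> _) set)) =
        real (card {g \<in> ?L. range g = E}) / real (card ?L)"
    proof eventually_elim
      case (elim m)
      let ?B = "Lin (window n m) (trunc n) :: ((nat \<Rightarrow> 'a) \<Rightarrow> _) set"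
      have "(\<lambda>x. x + b x) ` W \<in> trace_event n E \<longleftrightarrow> range (\<lambda>x. trunc n (\<psi> x + b (\<psi> x))) = E"
        if "b \<in> ?B" for b
      proof -
        have "trunc n ` (\<lambda>x. x + b x) ` W = range (\<lambda>x. trunc n (\<psi> x + b (\<psi> x)))"
          unfolding \<psi>(3)[symmetric] by (simp only: image_image)
        then show ?thesis
          using AutD(4)[OF Lin_window_shear_in_Aut[OF that] W(1)] by (simp add: trace_event_def)
      qed
      then have "{b \<in> ?B. (\<lambda>x. x + b x) ` W \<in> trace_event n E} =
          {b \<in> ?B. range (\<lambda>x. trunc n (\<psi> x + b (\<psi> x))) = E}" by blast
      moreover have "card {b \<in> ?B. range (\<lambda>x. trunc n (\<psi> x + b (\<psi> x))) = E} * card ?L =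
          card ?B * card {g \<in> ?L. range g = E}"
        by (rule card_shear_fibres[OF \<psi>(1,2)]) (use elim in blast)
      moreover have "card ?B > 0"
        using Lin_zero[OF lin_trunc, of "window n m" n] finite_Lin[OF finite_range_window finite_range_trunc]
        by (metis card_gt_0_iff empty_iff)
      moreover have "card ?L > 0" using q by (simp add: card_Lin_trunc)
      ultimately show ?case
        by (simp add: frac_eq_eq mult.commute flip: of_nat_mult)
    qed
    then show ?case by (rule tendsto_eventually)
  qed
qed

text \<open>An infinite \<open>W\<close> may meet F^n and has no finite parametrization, so only a
  \<open>k\<close>-dimensional piece independent of F^n is randomized. The proportion of shears for
  which even this piece misses \<open>v\<close> is bounded by a quantity that vanishes as
  \<open>k\<close> grows.\<close>

lemma CRS_infinite_AE_trace:
  fixes \<mu> :: "(nat \<Rightarrow> 'a::{field,finite}) set measure"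
  assumes CRS: "\<mu> \<in> CRSV" and inf: "AE W in \<mu>. infinite W" and v: "v \<in> range (trunc n)"
  shows "AE W in \<mu>. v \<in> trunc n ` W"
proof -
  interpret prob_space \<mu> using CRS by (simp add: CRS_def)
  have sets: "sets \<mu> = sets (borel_of SubT)" using CRS by (simp add: CRS_def)
  have space: "space \<mu> = SubV" using sets_eq_imp_space_eq[OF sets] by (simp add: space_borel_SubT)
  note q = CARD_field_gt_1[where 'a = 'a]
  \<comment> \<open>The proportion of vectors of F^n different from \<open>v\<close>: the
    probability that one uniformly random column avoids \<open>v\<close>.\<close>
  define \<rho> where "\<rho> = real (CARD('a) ^ n - 1) / real (CARD('a) ^ n)"
  have "real (CARD('a) ^ n) > 0" using q by simp
  then have \<rho>: "0 \<le> \<rho>" "\<rho> < 1" by (simp_all add: \<rho>_def)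
  let ?A = "{W \<in> SubV. v \<in> trunc n ` W}"
  have "measure \<mu> ?A = 1"
  proof (rule CRS_measure_eq_limit[OF CRS sets_hit_cylinder, where n = n])
    show "AE W in \<mu>. (\<lambda>m. real (card {b \<in> Lin (window n m) (trunc n). (\<lambda>x. x + b x) ` W \<in> ?A}) /
        real (card (Lin (window n m) (trunc n) :: ((nat \<Rightarrow> 'a) \<Rightarrow> _) set))) \<longlonglongrightarrow> 1"
      using inf AE_space
    proof eventually_elim
      case (elim W)
      have W: "W \<in> SubV" "fs.subspace W" using elim by (simp_all add: space SubV_iff)
      show ?case
      proof (rule LIMSEQ_I)
        fix \<epsilon> :: real assume "\<epsilon> > 0"
        then obtain k where k: "\<rho> ^ k < \<epsilon>" using real_arch_pow_inv \<rho>(2) by blast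
        obtain \<psi> where e: "embeds k \<psi> W (range (trunc n))"
          using embeds_infinite[OF W(2) elim(1) subspace_image_trunc finite_range_trunc] by blast
        then have \<psi>: "lin \<psi>" "\<And>x. \<psi> (trunc k x) = \<psi> x" "range \<psi> \<subseteq> W" by (auto simp: embeds_def)
        have "\<forall>\<^sub>F m in sequentially.
          norm (real (card {b \<in> Lin (window n m) (trunc n). (\<lambda>x. x + b x) ` W \<in> ?A}) /
            real (card (Lin (window n m) (trunc n) :: ((nat \<Rightarrow> 'a) \<Rightarrow> _) set)) - 1) < \<epsilon>"
          using embeds_eventually_window[OF e]
        proof eventually_elim
          case (elim m)
          let ?B = "Lin (window n m) (trunc n) :: ((nat \<Rightarrow> 'a) \<Rightarrow> _) set"
          let ?L = "Lin (trunc k) (trunc n) :: ((nat \<Rightarrow> 'a) \<Rightarrow> _) set"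
          let ?hit = "{b \<in> ?B. (\<lambda>x. x + b x) ` W \<in> ?A}"
          let ?miss = "{b \<in> ?B. v \<notin> range (\<lambda>x. trunc n (\<psi> x + b (\<psi> x)))}"
          have finB: "finite ?B" by (intro finite_Lin finite_range_window finite_range_trunc)
          have posB: "card ?B > 0" using finB Lin_zero[OF lin_trunc, of "window n m" n] by (metis card_gt_0_iff empty_iff)
          have posL: "card ?L > 0" using q by (simp add: card_Lin_trunc)
          \<comment> \<open>Only an inclusion: a shear for which the chosen piece misses
            \<open>v\<close> may still carry another vector of \<open>W\<close> to one that projects
            to \<open>v\<close>.\<close>
          have "?B \<subseteq> ?hit \<union> ?miss"
          proof
            fix b assume b: "b \<in> ?B"
            have "v \<in> trunc n ` (\<lambda>x. x + b x) ` W" if "v \<in> range (\<lambda>x. trunc n (\<psi> x + b (\<psi> x)))"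
              using that \<psi>(3) by blast
            then show "b \<in> ?hit \<union> ?miss"
              using b AutD(4)[OF Lin_window_shear_in_Aut[OF b] W(1)] by blast
          qed
          then have "card ?B \<le> card (?hit \<union> ?miss)"
            by (intro card_mono finite_subset[OF _ finB]) auto
          also have "\<dots> \<le> card ?hit + card ?miss" by (rule card_Un_le)
          finally have le: "real (card ?B) \<le> real (card ?hit) + real (card ?miss)" by linarith
          have "card ?miss * card ?L = card ?B * card {g \<in> ?L. v \<notin> range g}"
            by (rule card_shear_fibres[OF \<psi>(1,2)]) (use elim in blast)
          also have "\<dots> \<le> card ?B * (CARD('a) ^ n - 1) ^ k"
            using card_Lin_trunc_miss[OF v] by simp
          finally have "real (card ?miss * card ?L) \<le> real (card ?B * (CARD('a) ^ n - 1) ^ k)"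
            by (rule of_nat_mono)
          then have "real (card ?miss) * real (card ?L) \<le> real (card ?B) * real (CARD('a) ^ n - 1) ^ k"
            by (simp only: of_nat_mult of_nat_power)
          then have "real (card ?miss) / real (card ?B) \<le> \<rho> ^ k"
            using posB posL
            by (simp add: \<rho>_def card_Lin_trunc field_simps power_divide)
          moreover have "1 - real (card ?miss) / real (card ?B) \<le> real (card ?hit) / real (card ?B)"
            using divide_right_mono[OF le, of "real (card ?B)"] posB by (simp add: add_divide_distrib)
          moreover have "real (card ?hit) / real (card ?B) \<le> 1"
            using posB card_mono[OF finB, of ?hit] by (simp add: divide_le_eq_1)
          ultimately show ?case using k by simp
        qed
        then show "\<exists>no. \<forall>m\<ge>no.
          norm (real (card {b \<in> Lin (window n m) (trunc n). (\<lambda>x. x + b x) ` W \<in> ?A}) /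
            real (card (Lin (window n m) (trunc n) :: ((nat \<Rightarrow> 'a) \<Rightarrow> _) set)) - 1) < \<epsilon>"
          by (simp add: eventually_sequentially)
      qed
    qed
  qed
  then have "AE W in \<mu>. W \<in> ?A" using sets_hit_cylinder[of v n] by (intro AE_prob_1) auto
  then show ?thesis by eventually_elim simp
qed

text \<open>Almost surely all projections of \<open>W\<close> to the spaces F^n are onto, which
  means that \<open>W\<close> is dense; being closed, it is the whole space.\<close>

lemma CRS_infinite_imp_return:
  fixes \<mu> :: "(nat \<Rightarrow> 'a::{field,finite}) set measure"
  assumes CRS: "\<mu> \<in> CRSV" and inf: "AE W in \<mu>. infinite W"
  shows "\<mu> = return (borel_of SubT) UNIV"
proof -
  interpret prob_space \<mu> using CRS by (simp add: CRS_def)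
  have sets: "sets \<mu> = sets (borel_of SubT)" using CRS by (simp add: CRS_def)
  have space: "space \<mu> = SubV" using sets_eq_imp_space_eq[OF sets] by (simp add: space_borel_SubT)
  have "AE W in \<mu>. \<forall>n. \<forall>v\<in>range (trunc n). v \<in> trunc n ` W"
    unfolding AE_all_countable
    by (intro allI AE_finite_allI finite_range_trunc CRS_infinite_AE_trace[OF CRS inf])
  then have UNIV: "AE W in \<mu>. W = UNIV"
    using AE_space
  proof eventually_elim
    case (elim W)
    then have "openin (seq_space UNIV) (UNIV - W)" by (simp add: space SubV_iff closedin_def)
    moreover have "\<exists>y. trunc n y = trunc n x \<and> y \<in> W" for n x
    proof -
      have "trunc n x \<in> trunc n ` W" using elim(1) by blast
      then show ?thesis by (metis imageE)
    qed
    ultimately have "UNIV - W = {}" unfolding openin_seq_space_UNIV by blast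
    then show ?case by blast
  qed
  show ?thesis
  proof (rule measure_eqI)
    show "sets \<mu> = sets (return (borel_of SubT) UNIV)" by (simp add: sets)
    fix A assume A: "A \<in> sets \<mu>"
    \<comment> \<open>Up to a null set \<open>A\<close> is everything or nothing, according to
      whether it contains the whole space as an element.\<close>
    have "emeasure \<mu> A = emeasure \<mu> (if UNIV \<in> A then space \<mu> else {})"
      by (rule emeasure_eq_AE) (use UNIV AE_space A in \<open>auto elim!: eventually_mono\<close>)
    also have "\<dots> = emeasure (return (borel_of SubT) UNIV) A"
      using A by (simp add: sets emeasure_space_1)
    finally show "emeasure \<mu> A = emeasure (return (borel_of SubT) UNIV) A" .
  qed
qed

section \<open>Haar measure on the group of homomorphisms\<close>

abbreviation HomV :: "nat \<Rightarrow> ((nat \<Rightarrow> 'a::field) \<Rightarrow> nat \<Rightarrow> 'a) set" where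
  "HomV k \<equiv> Hom fscale (seq_space {..<k}) fscale (seq_space UNIV)"

abbreviation HomT :: "nat \<Rightarrow> ((nat \<Rightarrow> 'a::field) \<Rightarrow> nat \<Rightarrow> 'a) topology" where
  "HomT k \<equiv> Hom_topology fscale (seq_space {..<k}) fscale (seq_space UNIV)"

text \<open>F^k is discrete because \<open>trunc k\<close> is the identity on it. Continuity of
  homomorphisms out of it is therefore automatic.\<close>

lemma openin_seq_space_lessThan:
  fixes U :: "(nat \<Rightarrow> 'a::field) set"
  shows "openin (seq_space {..<k}) U \<longleftrightarrow> U \<subseteq> range (trunc k)"
proof -
  have "y = x" if "x \<in> range (trunc k)" "y \<in> range (trunc k)" "trunc k y = trunc k x" for x y :: "nat \<Rightarrow> 'a"
    using range_trunc_fixed[OF that(1)] range_trunc_fixed[OF that(2)] that(3) by simp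
  then have "\<forall>x\<in>U. \<exists>n. \<forall>y\<in>range (trunc k). trunc n y = trunc n x \<longrightarrow> y \<in> U"
    if "U \<subseteq> range (trunc k)" using that by (metis subsetD)
  then show ?thesis unfolding openin_seq_space topspace_seq_space_lessThan by blast
qed

lemma HomV_iff:
  fixes h :: "(nat \<Rightarrow> 'a::field) \<Rightarrow> nat \<Rightarrow> 'a"
  shows "h \<in> HomV k \<longleftrightarrow> h \<in> extensional (range (trunc k)) \<and>
    linear_on fscale fscale (range (trunc k)) h"
proof -
  have "continuous_map (seq_space {..<k}) (seq_space UNIV) h"
    unfolding continuous_map_def openin_seq_space_lessThan by (auto simp: topspace_seq_space_lessThan)
  then show ?thesis by (simp add: Hom_def topspace_seq_space_lessThan)
qed

lemma HomV_lin:
  fixes h :: "(nat \<Rightarrow> 'a::field) \<Rightarrow> nat \<Rightarrow> 'a"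
  assumes "h \<in> HomV k"
  shows "lin (\<lambda>x. h (trunc k x))"
proof -
  have "linear_on fscale fscale (range (trunc k)) h" using assms by (simp add: HomV_iff)
  moreover have "trunc k (x + y) = trunc k x + trunc k y" "trunc k (fscale c x) = fscale c (trunc k x)"
    for x y :: "nat \<Rightarrow> 'a" and c
    using lin_trunc[of k] by (auto simp: lin_iff)
  ultimately show ?thesis by (simp add: lin_iff linear_on_def)
qed

lemma restrict_in_HomV:
  assumes "lin g"
  shows "restrict g (range (trunc k)) \<in> HomV k"
  unfolding HomV_iff linear_on_def
proof (intro conjI ballI allI)
  note sub = subspace_image_trunc[of k]
  fix x y :: "nat \<Rightarrow> 'a" and c :: 'a
  assume x: "x \<in> range (trunc k)"
  then show "restrict g (range (trunc k)) (fscale c x) = fscale c (restrict g (range (trunc k)) x)"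
    using assms fs.subspace_scale[OF sub x] by (simp add: lin_iff)
  assume y: "y \<in> range (trunc k)"
  then show "restrict g (range (trunc k)) (x + y) =
      restrict g (range (trunc k)) x + restrict g (range (trunc k)) y"
    using assms x fs.subspace_add[OF sub x y] by (simp add: lin_iff)
qed simp

lemma HomV_trunc_in_Lin:
  fixes h :: "(nat \<Rightarrow> 'a::field) \<Rightarrow> nat \<Rightarrow> 'a"
  assumes "h \<in> HomV k"
  shows "(\<lambda>x. trunc n (h (trunc k x))) \<in> Lin (trunc k) (trunc n)"
  by (rule LinI) (auto simp: trunc_trunc intro!: lin_comp[OF lin_trunc] HomV_lin[OF assms])

section \<open>Cylinder sets in the group of homomorphisms\<close>

definition hom_cylinder :: "nat \<Rightarrow> nat \<Rightarrow> ((nat \<Rightarrow> 'a::field) \<Rightarrow> nat \<Rightarrow> 'a) \<Rightarrow> ((nat \<Rightarrow> 'a) \<Rightarrow> nat \<Rightarrow> 'a) set"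
  where
  "hom_cylinder k n g = {h \<in> HomV k. \<forall>x\<in>range (trunc k). trunc n (h x) = g x}"

text \<open>The empty set is adjoined to make the family closed under intersection. It also accounts
  for every function \<open>g\<close> that is not the truncation of a homomorphism on F^k.\<close>

definition hom_cylinders :: "nat \<Rightarrow> ((nat \<Rightarrow> 'a::field) \<Rightarrow> nat \<Rightarrow> 'a) set set" where
  "hom_cylinders k = insert {} (\<Union>n. hom_cylinder k n ` Lin (trunc k) (trunc n))"

lemma hom_cylinderD:
  assumes "h \<in> hom_cylinder k n g"
  shows "h \<in> HomV k" "x \<in> range (trunc k) \<Longrightarrow> trunc n (h x) = g x"
  using assms unfolding hom_cylinder_def by blast+

lemma hom_cylinderI:
  assumes "h \<in> HomV k" "\<And>x. x \<in> range (trunc k) \<Longrightarrow> trunc n (h x) = g x"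
  shows "h \<in> hom_cylinder k n g"
  using assms unfolding hom_cylinder_def by blast

lemma hom_cylinder_cong:
  assumes "\<And>x. x \<in> range (trunc k) \<Longrightarrow> g x = g' x"
  shows "hom_cylinder k n g = hom_cylinder k n g'"
  unfolding hom_cylinder_def using assms by auto

text \<open>As with balls in an ultrametric space, every member of a cylinder can serve as its
  centre. This makes cylinders nested or disjoint.\<close>

lemma hom_cylinder_eq:
  assumes "h \<in> hom_cylinder k n g"
  shows "hom_cylinder k n g = hom_cylinder k n (\<lambda>x. trunc n (h (trunc k x)))"
  by (rule hom_cylinder_cong) (metis assms hom_cylinderD(2) range_trunc_fixed)

lemma hom_cylinder_self:
  assumes "h \<in> HomV k"
  shows "h \<in> hom_cylinder k n (\<lambda>x. trunc n (h (trunc k x)))"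
  by (rule hom_cylinderI[OF assms]) (metis range_trunc_fixed)

lemma hom_cylinder_in: "hom_cylinder k n g \<in> hom_cylinders k"
proof (cases "hom_cylinder k n g = {}")
  case False
  then obtain h where h: "h \<in> hom_cylinder k n g" by blast
  then have "(\<lambda>x. trunc n (h (trunc k x))) \<in> Lin (trunc k) (trunc n)"
    by (intro HomV_trunc_in_Lin) (simp add: hom_cylinder_def)
  then show ?thesis unfolding hom_cylinders_def hom_cylinder_eq[OF h] by blast
qed (simp add: hom_cylinders_def)

lemma hom_cylinder_mono:
  assumes "m \<le> n"
  shows "hom_cylinder k n (\<lambda>x. trunc n (h (trunc k x))) \<subseteq> hom_cylinder k m (\<lambda>x. trunc m (h (trunc k x)))"
  using trunc_eq_mono[OF _ assms] by (auto simp: hom_cylinder_def)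

lemma topspace_HomT: "topspace (HomT k :: ((nat \<Rightarrow> 'a::field) \<Rightarrow> nat \<Rightarrow> 'a) topology) = HomV k"
proof -
  have "HomV k = {h \<in> HomV k :: ((nat \<Rightarrow> 'a) \<Rightarrow> nat \<Rightarrow> 'a) set. h ` {} \<subseteq> {}}" by simp
  then have "HomV k \<in> {{h \<in> HomV k :: ((nat \<Rightarrow> 'a) \<Rightarrow> nat \<Rightarrow> 'a) set. h ` K \<subseteq> U} | K U.
      compactin (seq_space {..<k}) K \<and> openin (seq_space UNIV) U}"
    using compactin_empty openin_empty by blast
  then show ?thesis unfolding Hom_topology_def topology_generated_by_topspace by blast
qed

lemma openin_hom_cylinder:
  fixes g :: "(nat \<Rightarrow> 'a::{field,finite}) \<Rightarrow> nat \<Rightarrow> 'a"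
  shows "openin (HomT k) (hom_cylinder k n g)"
proof -
  have "openin (HomT k) {h \<in> HomV k. trunc n (h x) = g x}" if x: "x \<in> range (trunc k)" for x
  proof -
    have "compactin (seq_space {..<k}) {x}"
      using x by (simp add: topspace_seq_space_lessThan)
    moreover have "{h \<in> HomV k. trunc n (h x) = g x} = {h \<in> HomV k. h ` {x} \<subseteq> {y. trunc n y = g x}}"
      by auto
    ultimately show ?thesis
      unfolding Hom_topology_def using openin_cylinder[of n "g x"]
      by (intro topology_generated_by_Basis) blast
  qed
  then have "openin (HomT k) (\<Inter>x\<in>range (trunc k). {h \<in> HomV k. trunc n (h x) = g x})"
    by (intro openin_Inter) (use finite_imageI[OF finite_range_trunc] in auto)
  moreover have "(\<Inter>x\<in>range (trunc k). {h \<in> HomV k. trunc n (h x) = g x}) = hom_cylinder k n g"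
    by (auto simp: hom_cylinder_def)
  ultimately show ?thesis by simp
qed

text \<open>A compact subset of F^k is finite, so a subbasic condition of the compact-open topology
  concerns finitely many values of \<open>h\<close>, and one level \<open>N\<close> controls them
  all.\<close>

lemma hom_cylinder_base:
  fixes h :: "(nat \<Rightarrow> 'a::{field,finite}) \<Rightarrow> nat \<Rightarrow> 'a"
  assumes U: "openin (HomT k) U" "h \<in> U"
  shows "\<exists>n. hom_cylinder k n (\<lambda>x. trunc n (h (trunc k x))) \<subseteq> U"
proof -
  let ?c = "\<lambda>n. hom_cylinder k n (\<lambda>x. trunc n (h (trunc k x)))"
  have "generate_topology_on {{h \<in> HomV k. h ` K \<subseteq> U} | K U.
      compactin (seq_space {..<k}) K \<and> openin (seq_space UNIV) U} U"
    using U(1) unfolding Hom_topology_def by (rule openin_topology_generated_by)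
  then show ?thesis using U(2)
  proof (induction rule: generate_topology_on.induct)
    case Empty
    then show ?case by simp
  next
    case (Int a b)
    then obtain m n where mn: "?c m \<subseteq> a" "?c n \<subseteq> b" by blast
    have "?c (max m n) \<subseteq> ?c m" "?c (max m n) \<subseteq> ?c n" by (rule hom_cylinder_mono, simp)+
    then show ?case using mn by blast
  next
    case (UN K)
    then show ?case by (meson Union_iff Union_upper order_trans)
  next
    case (Basis X)
    then obtain K G where KG: "compactin (seq_space {..<k}) K" "openin (seq_space UNIV) G"
      "X = {h \<in> HomV k. h ` K \<subseteq> G}" by blast
    have K: "K \<subseteq> range (trunc k)" using compactin_subset_topspace[OF KG(1)]
      by (simp add: topspace_seq_space_lessThan)
    have "finite K" using K finite_range_trunc by (rule finite_subset)
    have "\<forall>x\<in>K. \<exists>n. \<forall>y. trunc n y = trunc n (h x) \<longrightarrow> y \<in> G"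
      using KG Basis.prems unfolding openin_seq_space_UNIV by blast
    then obtain n where n: "\<And>x y. x \<in> K \<Longrightarrow> trunc (n x) y = trunc (n x) (h x) \<Longrightarrow> y \<in> G" by metis
    have "finite (n ` K)" using \<open>finite K\<close> by (rule finite_imageI)
    then obtain N where N: "\<forall>j\<in>n ` K. j < N" using finite_nat_set_iff_bounded by blast
    have "h' \<in> X" if h': "h' \<in> ?c N" for h'
    proof -
      have "h' x \<in> G" if x: "x \<in> K" for x
      proof (rule n[OF x])
        have xk: "x \<in> range (trunc k)" using x K by blast
        have "trunc N (h' x) = trunc N (h x)"
          using hom_cylinderD(2)[OF h' xk] by (simp only: range_trunc_fixed[OF xk])
        then show "trunc (n x) (h' x) = trunc (n x) (h x)"
          by (rule trunc_eq_mono) (use N x in force)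
      qed
      then show ?thesis unfolding KG(3) using hom_cylinderD(1)[OF h'] by blast
    qed
    then show ?case by blast
  qed
qed

lemma sets_borel_HomT:
  "sets (borel_of (HomT k)) =
    sigma_sets (HomV k) (hom_cylinders k :: ((nat \<Rightarrow> 'a::{field,finite}) \<Rightarrow> nat \<Rightarrow> 'a) set set)"
proof -
  have "sets (borel_of (HomT k)) =
    sigma_sets (topspace (HomT k)) (hom_cylinders k :: ((nat \<Rightarrow> 'a) \<Rightarrow> nat \<Rightarrow> 'a) set set)"
  proof (rule sets_borel_of_countable_base)
    show "countable (hom_cylinders k :: ((nat \<Rightarrow> 'a) \<Rightarrow> nat \<Rightarrow> 'a) set set)"
      unfolding hom_cylinders_def countable_insert_eq
      by (intro countable_UN countable_finite[OF finite_imageI[OF finite_Lin_trunc]]) (rule countableI_type)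
    show "hom_cylinders k \<subseteq> sets (borel_of (HomT k :: ((nat \<Rightarrow> 'a) \<Rightarrow> nat \<Rightarrow> 'a) topology))"
      unfolding hom_cylinders_def using borel_open[OF openin_hom_cylinder] by auto
    fix U and h :: "(nat \<Rightarrow> 'a) \<Rightarrow> nat \<Rightarrow> 'a"
    assume U: "openin (HomT k) U" "h \<in> U"
    then have "h \<in> HomV k" using openin_subset topspace_HomT by blast
    then show "\<exists>A\<in>hom_cylinders k. h \<in> A \<and> A \<subseteq> U"
    proof -
      obtain n where "hom_cylinder k n (\<lambda>x. trunc n (h (trunc k x))) \<subseteq> U"
        using hom_cylinder_base[OF U] by blast
      then show ?thesis using hom_cylinder_in hom_cylinder_self[OF \<open>h \<in> HomV k\<close>] by (intro bexI conjI)
    qed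
  qed
  then show ?thesis by (simp only: topspace_HomT)
qed

lemma space_borel_HomT: "space (borel_of (HomT k)) = HomV k"
  by (simp only: space_borel_of topspace_HomT)

lemma hom_cylinders_subset: "hom_cylinders k \<subseteq> Pow (HomV k)"
  unfolding hom_cylinders_def hom_cylinder_def by blast

lemma sets_hom_cylinder:
  "hom_cylinder k n g \<in> sets (borel_of (HomT k :: ((nat \<Rightarrow> 'a::{field,finite}) \<Rightarrow> nat \<Rightarrow> 'a) topology))"
  by (rule borel_open[OF openin_hom_cylinder])

lemma Int_stable_hom_cylinders: "Int_stable (hom_cylinders k)"
proof (rule Int_stableI)
  have *: "hom_cylinder k m g \<inter> hom_cylinder k n g' \<in> hom_cylinders k" if "m \<le> n"
    for m n and g g' :: "(nat \<Rightarrow> 'a) \<Rightarrow> nat \<Rightarrow> 'a"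
  proof (cases "hom_cylinder k m g \<inter> hom_cylinder k n g' = {}")
    case False
    then obtain h where h: "h \<in> hom_cylinder k m g" "h \<in> hom_cylinder k n g'" by blast
    have "hom_cylinder k m g \<inter> hom_cylinder k n g' = hom_cylinder k n g'"
      unfolding hom_cylinder_eq[OF h(1)] hom_cylinder_eq[OF h(2)] using hom_cylinder_mono[OF that] by blast
    then show ?thesis using hom_cylinder_in by simp
  qed (simp add: hom_cylinders_def)
  fix A B :: "((nat \<Rightarrow> 'a) \<Rightarrow> nat \<Rightarrow> 'a) set"
  assume "A \<in> hom_cylinders k" "B \<in> hom_cylinders k"
  then consider "A \<inter> B = {}"
    | m g n g' where "A = hom_cylinder k m g" "B = hom_cylinder k n g'"
    unfolding hom_cylinders_def by blast
  then show "A \<inter> B \<in> hom_cylinders k"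
  proof cases
    case 1
    then show ?thesis by (simp add: hom_cylinders_def)
  next
    case (2 m g n g')
    show ?thesis
    proof (cases "m \<le> n")
      case True
      then show ?thesis unfolding 2 by (rule *)
    next
      case False
      then show ?thesis unfolding 2 using *[of n m g' g] by (simp add: Int_commute)
    qed
  qed
qed

lemma disjoint_hom_cylinders: "disjoint_family_on (hom_cylinder k n) (Lin (trunc k) (trunc n))"
  unfolding disjoint_family_on_def
proof (intro ballI impI, rule ccontr)
  fix g1 g2 :: "(nat \<Rightarrow> 'a) \<Rightarrow> nat \<Rightarrow> 'a"
  assume g12: "g1 \<in> Lin (trunc k) (trunc n)" "g2 \<in> Lin (trunc k) (trunc n)" "g1 \<noteq> g2"
  assume "hom_cylinder k n g1 \<inter> hom_cylinder k n g2 \<noteq> {}"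
  then obtain h where h: "h \<in> hom_cylinder k n g1" "h \<in> hom_cylinder k n g2" by blast
  have "g1 (trunc k x) = g2 (trunc k x)" for x
    using hom_cylinderD(2)[OF h(1), of "trunc k x"] hom_cylinderD(2)[OF h(2), of "trunc k x"] by simp
  then have "g1 x = g2 x" for x using LinD(2)[OF g12(1)] LinD(2)[OF g12(2)] by metis
  then show False using g12(3) by blast
qed

section \<open>Haar measure as equidistribution on cylinders\<close>

text \<open>An explicit form of Haar measure. Since \<open>normalized_haar\<close> is a definite
  description, existence and uniqueness must both be known before any of its values can be computed;
  they are proved for this condition and transferred.\<close>

definition equidistributed :: "nat \<Rightarrow> ((nat \<Rightarrow> 'a::field) \<Rightarrow> nat \<Rightarrow> 'a) measure \<Rightarrow> bool" where
  "equidistributed k \<mu> \<longleftrightarrow> prob_space \<mu> \<and> sets \<mu> = sets (borel_of (HomT k)) \<and>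
    (\<forall>n. \<forall>g\<in>Lin (trunc k) (trunc n). measure \<mu> (hom_cylinder k n g) =
      1 / real (card (Lin (trunc k) (trunc n) :: ((nat \<Rightarrow> 'a) \<Rightarrow> nat \<Rightarrow> 'a) set)))"

lemma equidistributed_unique:
  fixes \<mu> \<nu> :: "((nat \<Rightarrow> 'a::{field,finite}) \<Rightarrow> nat \<Rightarrow> 'a) measure"
  assumes \<mu>: "equidistributed k \<mu>" and \<nu>: "equidistributed k \<nu>"
  shows "\<mu> = \<nu>"
proof (rule measure_eqI_generator_eq[OF Int_stable_hom_cylinders hom_cylinders_subset,
      where A = "\<lambda>_. HomV k"])
  interpret \<mu>: prob_space \<mu> using \<mu> by (simp add: equidistributed_def)
  interpret \<nu>: prob_space \<nu> using \<nu> by (simp add: equidistributed_def)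
  show "sets \<mu> = sigma_sets (HomV k) (hom_cylinders k)" "sets \<nu> = sigma_sets (HomV k) (hom_cylinders k)"
    using \<mu> \<nu> sets_borel_HomT by (auto simp: equidistributed_def)
  show "emeasure \<mu> X = emeasure \<nu> X" if "X \<in> hom_cylinders k" for X
    using that \<mu> \<nu>
    by (auto simp: hom_cylinders_def equidistributed_def \<mu>.emeasure_eq_measure \<nu>.emeasure_eq_measure)
  have "HomV k = hom_cylinder k 0 (\<lambda>_. 0)" by (simp add: hom_cylinder_def)
  then show "range (\<lambda>_ :: nat. HomV k) \<subseteq> (hom_cylinders k :: ((nat \<Rightarrow> 'a) \<Rightarrow> nat \<Rightarrow> 'a) set set)"
    using hom_cylinder_in by (metis image_subsetI)
  show "emeasure \<mu> (HomV k) \<noteq> \<infinity>" by simp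
qed simp

text \<open>Translations permute the cylinders of a given level by translating their
  centres.\<close>

lemma Hom_add_cylinder:
  fixes d :: "(nat \<Rightarrow> 'a::field) \<Rightarrow> nat \<Rightarrow> 'a"
  assumes d: "d \<in> HomV k"
  shows "{h \<in> HomV k. Hom_add (seq_space {..<k}) d h \<in> hom_cylinder k n g} =
    hom_cylinder k n (\<lambda>x. g x - trunc n (d (trunc k x)))"
proof -
  have fixed: "trunc k x = x" if "x \<in> range (trunc k)" for x :: "nat \<Rightarrow> 'a"
    using that by (rule range_trunc_fixed)
  have "Hom_add (seq_space {..<k}) d h \<in> HomV k" if "h \<in> HomV k" for h
  proof -
    have "Hom_add (seq_space {..<k}) d h =
        restrict (\<lambda>x. d (trunc k x) + h (trunc k x)) (range (trunc k))"
      unfolding Hom_add_def topspace_seq_space_lessThan by (rule restrict_ext) (simp only: fixed)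
    then show ?thesis using restrict_in_HomV[OF lin_add[OF HomV_lin[OF d] HomV_lin[OF that]]] by simp
  qed
  moreover have "trunc n (Hom_add (seq_space {..<k}) d h x) = g x \<longleftrightarrow>
      trunc n (h x) = g x - trunc n (d (trunc k x))" if "x \<in> range (trunc k)" for h x
    using that fixed[OF that]
    by (auto simp: Hom_add_def topspace_seq_space_lessThan trunc_add algebra_simps)
  ultimately show ?thesis unfolding hom_cylinder_def by blast
qed

lemma Lin_sub_HomV:
  assumes "d \<in> HomV k" "g \<in> Lin (trunc k) (trunc n)"
  shows "(\<lambda>x. g x - trunc n (d (trunc k x))) \<in> Lin (trunc k) (trunc n)"
  by (intro Lin_diff assms(2) HomV_trunc_in_Lin[OF assms(1)] lin_trunc)

lemma measurable_Hom_add: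
  fixes d :: "(nat \<Rightarrow> 'a::{field,finite}) \<Rightarrow> nat \<Rightarrow> 'a"
  assumes d: "d \<in> HomV k"
  shows "Hom_add (seq_space {..<k}) d \<in> measurable (borel_of (HomT k)) (borel_of (HomT k))"
proof (rule measurable_sigma_sets[OF sets_borel_HomT hom_cylinders_subset])
  \<comment> \<open>At level 0 the cylinder over the zero map is all of \<open>HomV k\<close>, so
    this instance says that translation preserves \<open>HomV k\<close>.\<close>
  have "Hom_add (seq_space {..<k}) d h \<in> HomV k" if "h \<in> HomV k" for h
    using Hom_add_cylinder[OF d, of 0 "\<lambda>_. 0"] that by (simp add: hom_cylinder_def) blast
  then show "Hom_add (seq_space {..<k}) d \<in> space (borel_of (HomT k)) \<rightarrow> HomV k"
    unfolding space_borel_HomT by blast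
  fix A :: "((nat \<Rightarrow> 'a) \<Rightarrow> nat \<Rightarrow> 'a) set" assume "A \<in> hom_cylinders k"
  then consider "A = {}" | n g where "A = hom_cylinder k n g" unfolding hom_cylinders_def by blast
  then show "Hom_add (seq_space {..<k}) d -` A \<inter> space (borel_of (HomT k)) \<in> sets (borel_of (HomT k))"
  proof cases
    case (2 n g)
    have "Hom_add (seq_space {..<k}) d -` A \<inter> space (borel_of (HomT k)) =
        {h \<in> HomV k. Hom_add (seq_space {..<k}) d h \<in> hom_cylinder k n g}"
      unfolding 2 space_borel_HomT by blast
    then show ?thesis unfolding Hom_add_cylinder[OF d] by (simp add: sets_hom_cylinder)
  qed simp
qed

lemma measure_distr_Hom_add:
  fixes \<mu> :: "((nat \<Rightarrow> 'a::{field,finite}) \<Rightarrow> nat \<Rightarrow> 'a) measure"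
  assumes \<mu>: "sets \<mu> = sets (borel_of (HomT k))" and d: "d \<in> HomV k"
  shows "measure (distr \<mu> (borel_of (HomT k)) (Hom_add (seq_space {..<k}) d)) (hom_cylinder k n g) =
    measure \<mu> (hom_cylinder k n (\<lambda>x. g x - trunc n (d (trunc k x))))"
proof -
  have space: "space \<mu> = HomV k" using sets_eq_imp_space_eq[OF \<mu>] by (simp only: space_borel_HomT)
  have meas: "Hom_add (seq_space {..<k}) d \<in> measurable \<mu> (borel_of (HomT k))"
    using measurable_Hom_add[OF d] by (simp add: measurable_cong_sets[OF \<mu> refl])
  have "Hom_add (seq_space {..<k}) d -` hom_cylinder k n g \<inter> space \<mu> =
      {h \<in> HomV k. Hom_add (seq_space {..<k}) d h \<in> hom_cylinder k n g}"
    unfolding space by blast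
  then show ?thesis
    using measure_distr[OF meas sets_hom_cylinder[of k n g]] by (simp add: Hom_add_cylinder[OF d])
qed

text \<open>A translate of an equidistributed measure is again equidistributed, so uniqueness
  identifies the two.\<close>

lemma equidistributed_imp_haar:
  fixes \<mu> :: "((nat \<Rightarrow> 'a::{field,finite}) \<Rightarrow> nat \<Rightarrow> 'a) measure"
  assumes \<mu>: "equidistributed k \<mu>"
  shows "is_normalized_haar (HomT k) (Hom_add (seq_space {..<k})) \<mu>"
  unfolding is_normalized_haar_def topspace_HomT
proof (intro conjI ballI)
  show p: "prob_space \<mu>" and s: "sets \<mu> = sets (borel_of (HomT k))"
    using \<mu> by (simp_all add: equidistributed_def)
  fix d :: "(nat \<Rightarrow> 'a) \<Rightarrow> nat \<Rightarrow> 'a" assume d: "d \<in> HomV k"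
  have meas: "Hom_add (seq_space {..<k}) d \<in> measurable \<mu> (borel_of (HomT k))"
    using measurable_Hom_add[OF d] by (simp add: measurable_cong_sets[OF s refl])
  have "equidistributed k (distr \<mu> (borel_of (HomT k)) (Hom_add (seq_space {..<k}) d))"
    unfolding equidistributed_def
    using prob_space.prob_space_distr[OF p meas] measure_distr_Hom_add[OF s d] Lin_sub_HomV[OF d] \<mu>
    by (simp add: equidistributed_def)
  then show "distr \<mu> (borel_of (HomT k)) (Hom_add (seq_space {..<k}) d) = \<mu>"
    using \<mu> by (rule equidistributed_unique)
qed

text \<open>Translations act transitively on the finitely many cylinders of level \<open>n\<close>,
  which therefore have equal mass; they partition the space, so the masses add up to 1.\<close>

lemma haar_imp_equidistributed:
  fixes \<mu> :: "((nat \<Rightarrow> 'a::{field,finite}) \<Rightarrow> nat \<Rightarrow> 'a) measure"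
  assumes \<mu>: "is_normalized_haar (HomT k) (Hom_add (seq_space {..<k})) \<mu>"
  shows "equidistributed k \<mu>"
proof -
  interpret prob_space \<mu> using \<mu> by (simp add: is_normalized_haar_def)
  have s: "sets \<mu> = sets (borel_of (HomT k))"
    and inv: "\<And>d. d \<in> HomV k \<Longrightarrow> distr \<mu> (borel_of (HomT k)) (Hom_add (seq_space {..<k}) d) = \<mu>"
    using \<mu> by (simp_all add: is_normalized_haar_def topspace_HomT)
  have space: "space \<mu> = HomV k" using sets_eq_imp_space_eq[OF s] by (simp only: space_borel_HomT)
  have "measure \<mu> (hom_cylinder k n g) =
      1 / real (card (Lin (trunc k) (trunc n) :: ((nat \<Rightarrow> 'a) \<Rightarrow> nat \<Rightarrow> 'a) set))"
    if g: "g \<in> Lin (trunc k) (trunc n)" for n g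
  proof -
    let ?L = "Lin (trunc k) (trunc n) :: ((nat \<Rightarrow> 'a) \<Rightarrow> nat \<Rightarrow> 'a) set"
    have same: "measure \<mu> (hom_cylinder k n g') = measure \<mu> (hom_cylinder k n g)" if g': "g' \<in> ?L" for g'
    proof -
      \<comment> \<open>Translation by the difference \<open>d\<close> carries the cylinder of
        \<open>g\<close> to that of \<open>g'\<close>.\<close>
      define d where "d = restrict (\<lambda>x. g' x - g x) (range (trunc k))"
      have d: "d \<in> HomV k"
        unfolding d_def by (intro restrict_in_HomV lin_sub LinD(1)[OF g] LinD(1)[OF g'])
      have "g' x - trunc n (d (trunc k x)) = g x" for x
        using LinD[OF g] LinD[OF g'] by (simp add: d_def trunc_diff)
      then show ?thesis using measure_distr_Hom_add[OF s d, of n g'] inv[OF d] by simp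
    qed
    have fin: "finite ?L" by (rule finite_Lin_trunc)
    have "space \<mu> = (\<Union>g'\<in>?L. hom_cylinder k n g')"
      unfolding space
    proof (intro set_eqI iffI)
      fix h :: "(nat \<Rightarrow> 'a) \<Rightarrow> nat \<Rightarrow> 'a" assume h: "h \<in> HomV k"
      show "h \<in> (\<Union>g'\<in>?L. hom_cylinder k n g')"
        by (rule UN_I) (rule HomV_trunc_in_Lin[OF h], rule hom_cylinder_self[OF h])
    qed (auto dest: hom_cylinderD(1))
    moreover have "disjoint_family_on (hom_cylinder k n) ?L" by (rule disjoint_hom_cylinders)
    ultimately have "1 = (\<Sum>g'\<in>?L. measure \<mu> (hom_cylinder k n g'))"
      using finite_measure_finite_Union[OF fin, of "hom_cylinder k n"] sets_hom_cylinder[of k n]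
      by (metis image_subsetI prob_space s)
    also have "\<dots> = real (card ?L) * measure \<mu> (hom_cylinder k n g)" using same by simp
    finally have "real (card ?L) * measure \<mu> (hom_cylinder k n g) = 1" by simp
    moreover from this have "real (card ?L) \<noteq> 0" by (metis mult_zero_left zero_neq_one)
    ultimately show ?thesis by (simp add: eq_divide_eq mult.commute)
  qed
  then show ?thesis using s prob_space_axioms by (simp add: equidistributed_def)
qed

lemma sum_fun_at: "(\<Sum>i\<in>I. f i) j = (\<Sum>i\<in>I. (f i j :: 'a::field))"
  by (induction I rule: infinite_finite_induct) auto

text \<open>The measure is the law of a matrix with independent uniform entries:
  \<open>X (i, j)\<close> is coordinate \<open>j\<close> of the image of basis vector
  \<open>i\<close>. Indexing by all pairs makes the sample space the full function type;
  \<open>H\<close> reads only \<open>i < k\<close>.\<close>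

lemma equidistributed_exists:
  "\<exists>\<mu> :: ((nat \<Rightarrow> 'a::{field,finite}) \<Rightarrow> nat \<Rightarrow> 'a) measure. equidistributed k \<mu>"
proof -
  define M :: "nat \<times> nat \<Rightarrow> 'a measure" where "M = (\<lambda>_. uniform_count_measure UNIV)"
  have M: "prob_space (M p)" "sets (M p) = UNIV" "space (M p) = UNIV" for p
    unfolding M_def by (auto intro: prob_space_uniform_count_measure
        simp: sets_uniform_count_measure space_uniform_count_measure)
  define P where "P = PiM UNIV M"
  interpret P: prob_space P unfolding P_def by (rule prob_space_PiM) (rule M)
  have spaceP: "space P = UNIV" by (simp add: P_def space_PiM M PiE_UNIV_domain)
  define H :: "(nat \<times> nat \<Rightarrow> 'a) \<Rightarrow> (nat \<Rightarrow> 'a) \<Rightarrow> nat \<Rightarrow> 'a"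
    where "H X = restrict (\<lambda>x j. \<Sum>i<k. x i * X (i, j)) (range (trunc k))" for X
  have H: "H X \<in> HomV k" for X
    unfolding H_def
    by (rule restrict_in_HomV)
      (auto simp: lin_iff fun_eq_iff fscale_def algebra_simps sum.distrib sum_distrib_left)
  \<comment> \<open>A cylinder of level \<open>n\<close> prescribes exactly \<open>k * n\<close>
    matrix entries, so its probability is a product of \<open>k * n\<close> factors 1/q.\<close>
  have cyl: "H X \<in> hom_cylinder k n g \<longleftrightarrow> (\<forall>i<k. \<forall>j<n. X (i, j) = g (unit_seq i) j)"
    if g: "g \<in> Lin (trunc k) (trunc n)" for X n g
  proof
    assume *: "H X \<in> hom_cylinder k n g"
    show "\<forall>i<k. \<forall>j<n. X (i, j) = g (unit_seq i) j"
    proof (intro allI impI)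
      fix i j assume ij: "i < k" "j < n"
      have u: "unit_seq i \<in> range (trunc k :: _ \<Rightarrow> nat \<Rightarrow> 'a)"
        unfolding mem_range_trunc using ij by (auto simp: unit_seq_def)
      then have "g (unit_seq i) = trunc n (H X (unit_seq i))" using hom_cylinderD(2)[OF *] by simp
      then have "g (unit_seq i) j = (\<Sum>l<k. unit_seq i l * X (l, j))"
        using u ij by (simp add: H_def trunc_def)
      also have "\<dots> = (\<Sum>l<k. if l = i then X (l, j) else 0)"
        by (rule sum.cong) (auto simp: unit_seq_def)
      also have "\<dots> = X (i, j)" using ij by simp
      finally show "X (i, j) = g (unit_seq i) j" by simp
    qed
  next
    assume *: "\<forall>i<k. \<forall>j<n. X (i, j) = g (unit_seq i) j"
    have "trunc n (H X x) = g x" if x: "x \<in> range (trunc k)" for x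
    proof
      fix j
      show "trunc n (H X x) j = g x j"
      proof (cases "j < n")
        case True
        have "g x j = (\<Sum>i<k. fscale (x i) (g (unit_seq i)) j)"
          by (subst Lin_trunc_eq_sum[OF g]) (rule sum_fun_at)
        also have "\<dots> = (\<Sum>i<k. x i * X (i, j))"
          using * True by (intro sum.cong) (auto simp: fscale_def)
        finally show ?thesis using x True by (simp add: H_def trunc_def)
      next
        case False
        have "g x j = trunc n (g x) j" using LinD(3)[OF g] by simp
        then show ?thesis using False by (simp add: trunc_def)
      qed
    qed
    then show "H X \<in> hom_cylinder k n g" using H by (intro hom_cylinderI)
  qed
  have emb: "H -` hom_cylinder k n g \<inter> space P =
      prod_emb UNIV M ({..<k} \<times> {..<n}) (\<Pi>\<^sub>E p\<in>{..<k} \<times> {..<n}. {g (unit_seq (fst p)) (snd p)})"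
    if g: "g \<in> Lin (trunc k) (trunc n)" for n g
    using cyl[OF g] by (auto simp: spaceP prod_emb_def M PiE_UNIV_domain restrict_def PiE_iff extensional_def)
  have sets: "H -` hom_cylinder k n g \<inter> space P \<in> sets P" if "g \<in> Lin (trunc k) (trunc n)" for n g
    unfolding emb[OF that] unfolding P_def by (rule sets_PiM_I) (auto simp: M)
  have meas: "H \<in> measurable P (borel_of (HomT k))"
  proof (rule measurable_sigma_sets[OF sets_borel_HomT hom_cylinders_subset])
    show "H \<in> space P \<rightarrow> HomV k" using H by blast
    fix A :: "((nat \<Rightarrow> 'a) \<Rightarrow> nat \<Rightarrow> 'a) set" assume "A \<in> hom_cylinders k"
    then show "H -` A \<inter> space P \<in> sets P" unfolding hom_cylinders_def using sets by auto
  qed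
  have "equidistributed k (distr P (borel_of (HomT k)) H)"
    unfolding equidistributed_def
  proof (intro conjI allI ballI)
    show "prob_space (distr P (borel_of (HomT k)) H)" by (rule P.prob_space_distr[OF meas])
    show "sets (distr P (borel_of (HomT k)) H) = sets (borel_of (HomT k))" by simp
    fix n and g :: "(nat \<Rightarrow> 'a) \<Rightarrow> nat \<Rightarrow> 'a" assume g: "g \<in> Lin (trunc k) (trunc n)"
    have "emeasure P (H -` hom_cylinder k n g \<inter> space P) =
        (\<Prod>p\<in>{..<k} \<times> {..<n}. emeasure (M p) {g (unit_seq (fst p)) (snd p)})"
      unfolding emb[OF g] unfolding P_def by (rule emeasure_PiM_emb) (auto simp: M)
    also have "\<dots> = (\<Prod>p\<in>{..<k} \<times> {..<n}. ennreal (1 / real CARD('a)))"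
      by (simp add: M_def emeasure_uniform_count_measure)
    also have "\<dots> = ennreal ((1 / real CARD('a)) ^ (k * n))"
      by (simp add: ennreal_power)
    finally have "measure P (H -` hom_cylinder k n g \<inter> space P) = (1 / real CARD('a)) ^ (k * n)"
      by (simp add: measure_def)
    then show "measure (distr P (borel_of (HomT k)) H) (hom_cylinder k n g) =
        1 / real (card (Lin (trunc k) (trunc n) :: ((nat \<Rightarrow> 'a) \<Rightarrow> nat \<Rightarrow> 'a) set))"
      using measure_distr[OF meas sets_hom_cylinder[of k n g]]
      by (simp add: card_Lin_trunc power_mult[symmetric] power_one_over mult.commute)
  qed
  then show ?thesis by blast
qed

lemma equidistributed_Hom_haar:
  "equidistributed k (Hom_haar fscale (seq_space {..<k}) fscale (seq_space UNIV) ::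
    ((nat \<Rightarrow> 'a::{field,finite}) \<Rightarrow> nat \<Rightarrow> 'a) measure)"
proof -
  obtain \<mu> :: "((nat \<Rightarrow> 'a) \<Rightarrow> nat \<Rightarrow> 'a) measure" where \<mu>: "equidistributed k \<mu>"
    using equidistributed_exists by blast
  have "Hom_haar fscale (seq_space {..<k}) fscale (seq_space UNIV) = \<mu>"
    unfolding Hom_haar_def normalized_haar_def
    by (rule the_equality)
      (use \<mu> equidistributed_imp_haar haar_imp_equidistributed equidistributed_unique in blast)+
  then show ?thesis using \<mu> by simp
qed

section \<open>The law of a random image\<close>

definition image_law :: "nat \<Rightarrow> (nat \<Rightarrow> 'a::{field,finite}) set measure" where
  "image_law k = distr (Hom_haar fscale (seq_space {..<k}) fscale (seq_space UNIV)) (borel_of SubT)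
    (\<lambda>h. h ` topspace (seq_space {..<k}))"

text \<open>The projection of the random image to F^n is the range of the truncated homomorphism,
  and that homomorphism is uniform among linear maps from F^k to F^n. This gives the same proportion
  as in \<open>CRS_measure_trace_event\<close>.\<close>

lemma
  fixes E :: "(nat \<Rightarrow> 'a::{field,finite}) set"
  shows prob_space_image_law: "prob_space (image_law k :: (nat \<Rightarrow> 'a) set measure)"
    and sets_image_law: "sets (image_law k :: (nat \<Rightarrow> 'a) set measure) = sets (borel_of SubT)"
    and measure_image_law: "measure (image_law k) (trace_event n E) =
      real (card {g \<in> Lin (trunc k) (trunc n). range g = E}) /
      real (card (Lin (trunc k) (trunc n) :: ((nat \<Rightarrow> 'a) \<Rightarrow> _) set))"
proof -
  define \<mu> :: "((nat \<Rightarrow> 'a) \<Rightarrow> nat \<Rightarrow> 'a) measure"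
    where "\<mu> = Hom_haar fscale (seq_space {..<k}) fscale (seq_space UNIV)"
  have \<mu>: "equidistributed k \<mu>" unfolding \<mu>_def by (rule equidistributed_Hom_haar)
  interpret prob_space \<mu> using \<mu> by (simp add: equidistributed_def)
  have s: "sets \<mu> = sets (borel_of (HomT k))" using \<mu> by (simp add: equidistributed_def)
  have space: "space \<mu> = HomV k" using sets_eq_imp_space_eq[OF s] by (simp only: space_borel_HomT)
  let ?im = "\<lambda>h :: (nat \<Rightarrow> 'a) \<Rightarrow> nat \<Rightarrow> 'a. h ` range (trunc k)"
  have law: "image_law k = distr \<mu> (borel_of SubT) ?im"
    by (simp add: image_law_def \<mu>_def topspace_seq_space_lessThan)
  have sub: "?im h \<in> SubV" if "h \<in> HomV k" for h
  proof (rule finite_subspace_SubV)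
    have "?im h = range (\<lambda>x. h (trunc k x))" by (simp only: image_image)
    then show "fs.subspace (?im h)" using subspace_range_lin[OF HomV_lin[OF that]] by simp
    show "finite (?im h)" by (rule finite_imageI[OF finite_range_trunc])
  qed
  \<comment> \<open>The event splits into finitely many disjoint cylinders, one for each linear map
    with the prescribed range; this yields both measurability and the count.\<close>
  have pre: "{h \<in> space \<mu>. trunc n ` ?im h = E} =
      (\<Union>g\<in>{g \<in> Lin (trunc k) (trunc n). range g = E}. hom_cylinder k n g)"
    for n and E :: "(nat \<Rightarrow> 'a) set"
  proof -
    have im: "trunc n ` ?im h = range g" if "g \<in> Lin (trunc k) (trunc n)" "h \<in> hom_cylinder k n g" for g h
    proof -
      have "trunc n ` ?im h = range (\<lambda>x. trunc n (h (trunc k x)))" by (simp only: image_image)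
      also have "(\<lambda>x. trunc n (h (trunc k x))) = g"
        using hom_cylinderD(2)[OF that(2)] LinD(2)[OF that(1)] by (intro ext) simp
      finally show ?thesis .
    qed
    show ?thesis
    proof (intro set_eqI iffI)
      fix h assume h: "h \<in> {h \<in> space \<mu>. trunc n ` ?im h = E}"
      then have "h \<in> HomV k" by (simp add: space)
      from hom_cylinder_self[OF this] HomV_trunc_in_Lin[OF this]
      show "h \<in> (\<Union>g\<in>{g \<in> Lin (trunc k) (trunc n). range g = E}. hom_cylinder k n g)"
        using im h by blast
    next
      fix h assume "h \<in> (\<Union>g\<in>{g \<in> Lin (trunc k) (trunc n). range g = E}. hom_cylinder k n g)"
      then show "h \<in> {h \<in> space \<mu>. trunc n ` ?im h = E}"
        using im hom_cylinderD(1) unfolding space by blast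
    qed
  qed
  have fin: "finite {g \<in> Lin (trunc k) (trunc n) :: ((nat \<Rightarrow> 'a) \<Rightarrow> _) set. range g = E}"
    for n and E :: "(nat \<Rightarrow> 'a) set"
    by (rule finite_subset[OF _ finite_Lin_trunc]) auto
  have meas: "?im \<in> measurable \<mu> (borel_of SubT)"
  proof (rule measurable_borel_SubTI)
    show "?im h \<in> SubV" if "h \<in> space \<mu>" for h using sub that by (simp add: space)
    show "{h \<in> space \<mu>. trunc n ` ?im h = E} \<in> sets \<mu>"
      for n and E :: "(nat \<Rightarrow> 'a) set"
      unfolding pre by (intro sets.finite_UN fin) (simp add: s sets_hom_cylinder)
  qed
  show "prob_space (image_law k :: (nat \<Rightarrow> 'a) set measure)" unfolding law by (rule prob_space_distr[OF meas])
  show "sets (image_law k :: (nat \<Rightarrow> 'a) set measure) = sets (borel_of SubT)" by (simp add: law)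
  show "measure (image_law k) (trace_event n E) =
      real (card {g \<in> Lin (trunc k) (trunc n). range g = E}) /
      real (card (Lin (trunc k) (trunc n) :: ((nat \<Rightarrow> 'a) \<Rightarrow> _) set))"
  proof -
    let ?S = "{g \<in> Lin (trunc k) (trunc n) :: ((nat \<Rightarrow> 'a) \<Rightarrow> _) set. range g = E}"
    have "disjoint_family_on (hom_cylinder k n) ?S"
      by (rule disjoint_family_on_mono[OF _ disjoint_hom_cylinders]) auto
    then have "measure \<mu> (\<Union>g\<in>?S. hom_cylinder k n g) = (\<Sum>g\<in>?S. measure \<mu> (hom_cylinder k n g))"
      by (intro finite_measure_finite_Union fin) (auto simp: s sets_hom_cylinder)
    also have "\<dots> = (\<Sum>g\<in>?S. 1 / real (card (Lin (trunc k) (trunc n) :: ((nat \<Rightarrow> 'a) \<Rightarrow> _) set)))"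
      using \<mu> by (intro sum.cong) (auto simp: equidistributed_def)
    finally have *: "measure \<mu> (\<Union>g\<in>?S. hom_cylinder k n g) =
        real (card ?S) / real (card (Lin (trunc k) (trunc n) :: ((nat \<Rightarrow> 'a) \<Rightarrow> _) set))" by simp
    have "?im -` trace_event n E \<inter> space \<mu> = {h \<in> space \<mu>. trunc n ` ?im h = E}"
      using sub by (auto simp: trace_event_def space)
    then show ?thesis
      using measure_distr[OF meas sets_trace_event[of n E]] * by (simp only: law pre)
  qed
qed

text \<open>The event says that the first coordinate vanishes on the whole subspace. Among the q^k
  linear maps from F^k to the line F^1 only the zero map has this range, so the value separates
  different \<open>k\<close>.\<close>

lemma measure_image_law_zero:
  "measure (image_law k :: (nat \<Rightarrow> 'a::{field,finite}) set measure) (trace_event 1 {0}) = 1 / real (CARD('a) ^ k)"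
proof -
  have "{g \<in> Lin (trunc k) (trunc 1) :: ((nat \<Rightarrow> 'a) \<Rightarrow> _) set. range g = {0}} = {\<lambda>_. 0}"
  proof (intro set_eqI iffI)
    fix g :: "(nat \<Rightarrow> 'a) \<Rightarrow> nat \<Rightarrow> 'a"
    assume "g \<in> {g \<in> Lin (trunc k) (trunc 1). range g = {0}}"
    then have "range g = {0}" by blast
    then have "g x = 0" for x by blast
    then show "g \<in> {\<lambda>_. 0}" by (simp only: singleton_iff) (rule ext)
  qed (use Lin_zero[OF lin_trunc] in auto)
  then show ?thesis by (simp add: measure_image_law card_Lin_trunc)
qed

theorem theorem1p5:
  fixes lam :: "(nat \<Rightarrow> 'a::{field, finite}) set measure"
  assumes "lam \<in> CRSe fscale (seq_space UNIV)"
    and "lam \<noteq> return (borel_of (Sub_topology fscale (seq_space UNIV))) (topspace (seq_space UNIV))"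
  shows "\<exists>!k::nat. distr (Hom_haar fscale (seq_space {..<k}) fscale (seq_space UNIV))
           (borel_of (Sub_topology fscale (seq_space UNIV))) (\<lambda>h. h ` topspace (seq_space {..<k})) = lam"
  unfolding image_law_def[symmetric]
proof (rule ex_ex1I)
  have CRS: "lam \<in> CRSV" using assms(1) by (simp add: CRSe_def extreme_measures_def)
  interpret prob_space lam using CRS by (simp add: CRS_def)
  have sets: "sets lam = sets (borel_of SubT)" using CRS by (simp add: CRS_def)
  have space: "space lam = SubV" using sets_eq_imp_space_eq[OF sets] by (simp add: space_borel_SubT)
  obtain m where m: "AE W in lam. card W = m" using CRSe_AE_card[OF assms(1)] by blast
  have "m \<noteq> 0"
  proof
    assume "m = 0"
    \<comment> \<open>A subspace is nonempty, so cardinality 0 can only be the default value for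
      infinite sets.\<close>
    have "AE W in lam. infinite W"
      using m AE_space
    proof eventually_elim
      case (elim W)
      then show ?case using \<open>m = 0\<close> fs.subspace_0[of W] by (auto simp: space SubV_iff)
    qed
    then show False using CRS_infinite_imp_return[OF CRS] assms(2) by simp
  qed
  have "AE W in lam. \<exists>k. card W = m \<and> m = CARD('a) ^ k"
    using m AE_space
  proof eventually_elim
    case (elim W)
    then have "finite W" "fs.subspace W" using \<open>m \<noteq> 0\<close> by (auto simp: space SubV_iff intro: card_ge_0_finite)
    then obtain k \<psi> where "embeds k \<psi> W {0}" "range \<psi> = W" using embeds_finite by blast
    then show ?case using embeds_card[of k \<psi> W "{0}"] elim(1) by auto
  qed
  \<comment> \<open>The cardinality \<open>m\<close> is deterministic, so a single subspace from the
    almost sure event supplies an exponent valid for all of them.\<close>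
  from eventually_happens'[OF ae_filter_bot this] obtain k where k: "m = CARD('a) ^ k" by auto
  have "AE W in lam. card W = CARD('a) ^ k" using m unfolding k .
  note law = CRS_measure_trace_event[OF CRS this]
  have "image_law k = lam"
    by (rule measure_eqI_trace_events[OF prob_space_image_law sets_image_law prob_space_axioms sets])
      (simp only: measure_image_law law)
  then show "\<exists>k. image_law k = lam" by blast
next
  fix k k' assume "image_law k = lam" "image_law k' = lam"
  \<comment> \<open>Both sides are the probability under \<open>lam\<close> that the first
    coordinate vanishes on the random subspace.\<close>
  then have "1 / real (CARD('a) ^ k) = 1 / real (CARD('a) ^ k')"
    using measure_image_law_zero[where 'a = 'a] by metis
  then have "real CARD('a) ^ k = real CARD('a) ^ k'" by simp
  then show "k = k'" using CARD_field_gt_1[where 'a = 'a] by (simp add: power_inject_exp)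
qed

end
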